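(* Let $n\ge 1$, let $K$ be a nowhere flat locally connected subset of $\mathbb{R}^n$, and let $A$ be an analytic subspace of $K$ that is non-meager in $K$. Then the $n$-fold sum $A^{+n}$ is a non-meager analytic subset of $\mathbb{R}^n$, the $2n$-fold sum $A^{+2n}$ has non-empty interior in $\mathbb{R}^n$, and the set $(A-A)^{+n}$ is a neighborhood of zero in $\mathbb{R}^n$. Moreover, the set $A$ belongs to the families $\mathcal A(\mathbb{R}^n)=\mathcal B(\mathbb{R}^n)\subset\mathcal C(\mathbb{R}^n)$.
   Context: A subset $A$ of a real topological vector space $X$ is flat if its affine hull is nowhere dense in $X$ (for $X=\mathbb{R}^n$: the affine hull is not all of $\mathbb{R}^n$); $A$ is nowhere flat if each non-empty relatively open subset $U\subset A$ is not flat in $X$. For $T\subset X$ and $m\in\mathbb{N}$, $T^{+m}=T+\dots+T$ ($m$ times) $=\{t_1+\dots+t_m: t_1,\dots,t_m\in T\}$, and $A-A=\{a-b:a,b\in A\}$. A subspace of $\mathbb{R}^n$ is analytic if it is a continuous image of a Polish space (or empty). "Non-meager in $K$" means not of first category in the space $K$ with its subspace topology. A function $f:X\to\mathbb{R}$ is additive if $f(x+y)=f(x)+f(y)$ for all $x,y\in X$. A function $f:D\to\mathbb{R}$ on a convex set $D\subset X$ is mid-convex if $f\big(\tfrac{x+y}{2}\big)\le\tfrac{f(x)+f(y)}{2}$ for all $x,y\in D$. $\mathcal A(X)$ is the family of all $T\subset X$ such that every mid-convex function $f:D\to\mathbb{R}$ defined on a convex open set $D\subset X$ containing $T$ is continuous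 if $\sup f(T)<\infty$. $\mathcal B(X)$ is the family of all $T\subset X$ such that every additive function $f:X\to\mathbb{R}$ with $\sup f(T)<\infty$ is continuous. $\mathcal C(X)$ is the family of all $T\subset X$ such that every additive function $f:X\to\mathbb{R}$ for which $f(T)$ is bounded in $\mathbb{R}$ is continuous. It is a known result (Ger and Kominek) that $\mathcal A(\mathbb{R}^n)=\mathcal B(\mathbb{R}^n)$. *)

theory Defs
  imports "HOL-Analysis.Analysis"
begin

definition nowhere_dense_in :: "'a topology \<Rightarrow> 'a set \<Rightarrow> bool"
  where "nowhere_dense_in X S \<longleftrightarrow> S \<subseteq> topspace X \<and> X interior_of (X closure_of S) = {}"

definition meager_in :: "'a topology \<Rightarrow> 'a set \<Rightarrow> bool"
  where "meager_in X S \<longleftrightarrow>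
    (\<exists>\<N>. countable \<N> \<and> (\<forall>N\<in>\<N>. nowhere_dense_in X N) \<and> S = \<Union>\<N>)"

definition flat :: "'a::real_normed_vector set \<Rightarrow> bool"
  where "flat A \<longleftrightarrow> nowhere_dense_in euclidean (affine hull A)"

definition nowhere_flat :: "'a::real_normed_vector set \<Rightarrow> bool"
  where "nowhere_flat A \<longleftrightarrow> (\<forall>U. openin (top_of_set A) U \<and> U \<noteq> {} \<longrightarrow> \<not> flat U)"

definition Polish_space :: "'a topology \<Rightarrow> bool"
  where "Polish_space X \<longleftrightarrow> completely_metrizable_space X \<and> second_countable X"

text \<open>
  Continuous images of Polish spaces. The witnessing space has its points in the type of reals
  because one cannot quantify over types. This is no restriction, since a Polish space has at most
  continuum many points: see \<open>analytic_set_continuous_image\<close> below, where the Polish space has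
  an arbitrary type of points. The space may be empty, so the empty set is analytic.
\<close>

definition analytic_set :: "'a::topological_space set \<Rightarrow> bool"
  where "analytic_set A \<longleftrightarrow>
    (\<exists>(X::real topology) f. Polish_space X \<and> continuous_map X euclidean f \<and> f ` topspace X = A)"

lemma Polish_space_lepoll_reals:
  assumes "Polish_space X"
  shows "topspace X \<lesssim> (UNIV::real set)"
proof -
  have sc: "second_countable X" and "Hausdorff_space X"
    using assms by (auto simp: Polish_space_def completely_metrizable_imp_metrizable_space
        metrizable_imp_Hausdorff_space)
  then have t0: "t0_space X"
    using Hausdorff_imp_t1_space t1_imp_t0_space by blast
  obtain \<B> where \<B>: "countable \<B>" "\<And>V. V \<in> \<B> \<Longrightarrow> openin X V"
      "\<And>U x. openin X U \<Longrightarrow> x \<in> U \<Longrightarrow> \<exists>V \<in> \<B>. x \<in> V \<and> V \<subseteq> U"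
    using sc unfolding second_countable_def by metis
  define g where "g \<equiv> \<lambda>x. to_nat_on \<B> ` {V\<in>\<B>. x \<in> V}"
  have "inj_on g (topspace X)"
  proof (rule inj_onI, rule ccontr)
    fix x y assume xy: "x \<in> topspace X" "y \<in> topspace X" "g x = g y" "x \<noteq> y"
    have eq: "{V\<in>\<B>. x \<in> V} = {V\<in>\<B>. y \<in> V}"
      using xy(3) unfolding g_def
      by (subst (asm) inj_on_image_eq_iff[OF inj_on_to_nat_on[OF \<B>(1)]]) auto
    obtain U where "openin X U" "\<not> (x \<in> U \<longleftrightarrow> y \<in> U)"
      using t0 xy unfolding t0_space_def by blast
    then show False
      using \<B>(3) eq by blast
  qed
  then have "topspace X \<lesssim> (UNIV::nat set set)"
    by (auto simp: lepoll_def)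
  then show ?thesis
    using nat_sets_eqpoll_reals lepoll_trans2 by blast
qed

lemma analytic_set_continuous_image:
  assumes X: "Polish_space X" and f: "continuous_map X euclidean f"
  shows "analytic_set (f ` topspace X)"
proof -
  obtain g :: "_ \<Rightarrow> real" where g: "inj_on g (topspace X)"
    using Polish_space_lepoll_reals[OF X] by (auto simp: lepoll_def)
  define h where "h \<equiv> inv_into (topspace X) g"
  define Y where "Y \<equiv> pullback_topology (g ` topspace X) h X"
  have hg: "h (g x) = x" if "x \<in> topspace X" for x
    using that g by (simp add: h_def)
  have top: "topspace Y = g ` topspace X"
    by (auto simp: Y_def topspace_pullback_topology hg)
  have h: "continuous_map Y X h"
    using continuous_map_pullback[OF continuous_map_id] by (auto simp: Y_def o_def id_def)
  have "continuous_map X X (h \<circ> g)"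
    by (rule continuous_map_eq[OF continuous_map_id]) (simp add: hg)
  then have "continuous_map X Y g"
    unfolding Y_def by (rule continuous_map_pullback') auto
  then have hom: "homeomorphic_maps Y X h g"
    using h hg by (auto simp: homeomorphic_maps_def top)
  then have "Y homeomorphic_space X"
    by (auto simp: homeomorphic_space_def)
  then have "Polish_space Y"
    using X homeomorphic_completely_metrizable_space homeomorphic_space_second_countability
    unfolding Polish_space_def by blast
  moreover have "continuous_map Y euclidean (f \<circ> h)"
    using h f continuous_map_compose by blast
  moreover have "(f \<circ> h) ` topspace Y = f ` topspace X"
    by (force simp: top hg)
  ultimately show ?thesis
    unfolding analytic_set_def by blast
qed

definition nfold_sum :: "nat \<Rightarrow> 'a::comm_monoid_add set \<Rightarrow> 'a set"
  where "nfold_sum m T = {\<Sum>i<m. t i | t. \<forall>i<m. t i \<in> T}"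

definition mid_convex_on :: "'a::real_vector set \<Rightarrow> ('a \<Rightarrow> real) \<Rightarrow> bool"
  where "mid_convex_on D f \<longleftrightarrow>
    (\<forall>x\<in>D. \<forall>y\<in>D. f ((1/2) *\<^sub>R (x + y)) \<le> (f x + f y) / 2)"

definition family_A :: "'a::real_normed_vector set set"
  where "family_A = {T. \<forall>D f. open D \<and> convex D \<and> T \<subseteq> D \<and> mid_convex_on D f \<and> bdd_above (f ` T)
    \<longrightarrow> continuous_on D f}"

text \<open>The qualifier selects additive maps rather than additive set functions in measure theory.\<close>

definition family_B :: "'a::real_normed_vector set set"
  where "family_B = {T. \<forall>f::'a \<Rightarrow> real. Modules.additive f \<and> bdd_above (f ` T) \<longrightarrow> continuous_on UNIV f}"

definition family_C :: "'a::real_normed_vector set set"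
  where "family_C = {T. \<forall>f::'a \<Rightarrow> real. Modules.additive f \<and> bounded (f ` T) \<longrightarrow> continuous_on UNIV f}"

end

theory Submission
  imports Defs
begin

text \<open>
  If \<open>A\<^sup>+\<^sup>n\<close> were covered by countably many closed nowhere dense sets, then, by an argument of
  Kuratowski--Ulam type in \<open>K\<^sup>n\<close>, one of these sets would contain \<open>V\<^sub>1 + \<dots> + V\<^sub>n\<close> for some
  non-empty open sets \<open>V\<^sub>i\<close> of \<open>K\<close>, which may be taken connected and bounded. As no \<open>V\<^sub>i\<close> is flat, there are
  points \<open>a\<^sub>i\<close>, \<open>b\<^sub>i\<close> of \<open>V\<^sub>i\<close> with linearly independent differences \<open>b\<^sub>i - a\<^sub>i\<close>. By Brouwer's theorem the
  translates of the sum of the closures of the \<open>V\<^sub>i\<close> by the lattice spanned by these differences cover the space, so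
  that this sum has interior points by the Baire category theorem, a contradiction.
  The statements on \<open>A\<^sup>+\<^sup>2\<^sup>n\<close> and \<open>(A - A)\<^sup>+\<^sup>n\<close> follow since analytic sets have the Baire property.

  For \<open>family_B \<subseteq> family_A\<close>: a mid-convex function has an additive support at every point (Hahn--Banach over the
  rationals). If the function is bounded above on a member of \<open>family_B\<close>, then so are its supports, which are
  therefore linear; a function with linear supports is convex, hence continuous.
\<close>

section \<open>Mid-convex and additive functions\<close>

text \<open>Subadditivity bounds \<open>q (n x)\<close> from above. The doubling condition gives the
  lower bound at powers of two, and splitting \<open>2 ^ n\<close> as \<open>n + (2 ^ n - n)\<close>
  carries it over to every \<open>n\<close>.\<close>

lemma subadditive_multiple:
  fixes q :: "'a::real_vector \<Rightarrow> real"
  assumes sub: "\<And>x y. q (x + y) \<le> q x + q y" and dbl: "\<And>x. 2 * q x \<le> q (x + x)"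
  shows "q (real n *\<^sub>R x) = real n * q x"
proof -
  have q0: "q 0 = 0"
    using sub[of 0 0] dbl[of 0] by simp
  have upper: "q (real n *\<^sub>R x) \<le> real n * q x" for n
  proof (induction n)
    case (Suc n)
    then show ?case
      using sub[of x "real n *\<^sub>R x"] by (simp add: algebra_simps)
  qed (simp add: q0)
  have pow: "2 ^ k * q x \<le> q (2 ^ k *\<^sub>R x)" for k
  proof (induction k)
    case (Suc k)
    then show ?case
      using dbl[of "2 ^ k *\<^sub>R x"] by (simp flip: scaleR_left_distrib)
  qed simp
  have n: "n \<le> 2 ^ n"
    by (rule less_imp_le) simp
  have "2 ^ n *\<^sub>R x = real n *\<^sub>R x + real (2 ^ n - n) *\<^sub>R x"
    using n by (simp add: of_nat_diff algebra_simps)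
  then have "2 ^ n * q x \<le> q (real n *\<^sub>R x) + real (2 ^ n - n) * q x"
    using pow[of n] sub[of "real n *\<^sub>R x" "real (2 ^ n - n) *\<^sub>R x"] upper[of "2 ^ n - n"] by simp
  then have "real n * q x \<le> q (real n *\<^sub>R x)"
    using n by (simp add: of_nat_diff algebra_simps)
  with upper show ?thesis
    by (simp add: order_antisym)
qed

text \<open>A minimal element among the sublinear minorants of \<open>p\<close> is additive, because
  \<open>q\<close> dominates the sublinear function \<open>\<lambda>x. INF n. q (x + n y) - n q y\<close>.\<close>

lemma additive_minorant:
  fixes p :: "'a::real_vector \<Rightarrow> real"
  assumes sub: "\<And>x y. p (x + y) \<le> p x + p y" and dbl: "\<And>x. 2 * p x \<le> p (x + x)"
  obtains a where "Modules.additive a" "\<And>x. a x \<le> p x"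
proof -
  define S where "S = {q :: 'a \<Rightarrow> real. (\<forall>x y. q (x + y) \<le> q x + q y) \<and> (\<forall>x. 2 * q x \<le> q (x + x)) \<and> (\<forall>x. q x \<le> p x)}"
  \<comment> \<open>The order is reversed, so that the maximal element supplied by Zorn's lemma is a
    minimal minorant.\<close>
  define R where "R = (\<lambda>f g :: 'a \<Rightarrow> real. \<forall>x. g x \<le> f x)"
  have po: "partial_order_on S (relation_of R S)"
    unfolding partial_order_on_def preorder_on_def refl_on_def trans_def antisym_def relation_of_def R_def
    by (auto simp: fun_eq_iff intro: order_trans order_antisym)
  \<comment> \<open>A lower bound that does not depend on \<open>q\<close>; it keeps the infimum
    over a chain finite.\<close>
  have lower: "- p (- x) \<le> q x" if "q \<in> S" for q x
  proof -
    have *: "\<And>x y. q (x + y) \<le> q x + q y" "\<And>x. 2 * q x \<le> q (x + x)" "\<And>x. q x \<le> p x"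
      using that by (auto simp: S_def)
    show ?thesis
      using *(1)[of x "-x"] *(1)[of 0 0] *(2)[of 0] *(3)[of "-x"] by simp
  qed
  have "\<exists>m\<in>S. \<forall>a\<in>S. R m a \<longrightarrow> a = m"
  proof (rule predicate_Zorn[OF po])
    fix C assume C: "C \<in> Chains (relation_of R S)"
    then have CS: "C \<subseteq> S"
      by (rule Chains_relation_of)
    show "\<exists>u\<in>S. \<forall>a\<in>C. R a u"
    proof (cases "C = {}")
      case True
      have "p \<in> S" using sub dbl by (auto simp: S_def)
      then show ?thesis using True by auto
    next
      case False
      define u where "u = (\<lambda>x. INF q\<in>C. q x)"
      have bdd: "bdd_below ((\<lambda>q. q x) ` C)" for x
        using lower CS by (auto simp: bdd_below_def)
      have u_le: "u x \<le> q x" if "q \<in> C" for q x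
        unfolding u_def using bdd that by (rule cINF_lower)
      have le_u: "c \<le> u x" if "\<And>q. q \<in> C \<Longrightarrow> c \<le> q x" for c x
        unfolding u_def using False that by (rule cINF_greatest)
      have subu: "u (x + y) \<le> u x + u y" for x y
      proof -
        \<comment> \<open>Two members of a chain are comparable, and the smaller one serves for both
          summands.\<close>
        have "u (x + y) \<le> q1 x + q2 y" if q: "q1 \<in> C" "q2 \<in> C" for q1 q2
        proof -
          have "R q1 q2 \<or> R q2 q1"
            using C q unfolding Chains_def relation_of_def by blast
          then obtain q where qq: "q \<in> C" "\<And>z. q z \<le> q1 z" "\<And>z. q z \<le> q2 z"
            using q unfolding R_def by blast
          have "q (x + y) \<le> q x + q y"
            using qq CS unfolding S_def by auto
          then show ?thesis
            using u_le[OF qq(1), of "x + y"] qq(2)[of x] qq(3)[of y] by linarith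
        qed
        then have "u (x + y) - q1 x \<le> u y" if "q1 \<in> C" for q1
          using that by (intro le_u) (fastforce simp: algebra_simps)
        then have "u (x + y) - u y \<le> u x"
          by (intro le_u) (fastforce simp: algebra_simps)
        then show ?thesis by simp
      qed
      have "2 * u x \<le> u (x + x)" for x
      proof (rule le_u)
        fix q assume q: "q \<in> C"
        then have "2 * q x \<le> q (x + x)" using CS by (auto simp: S_def)
        then show "2 * u x \<le> q (x + x)" using u_le[OF q, of x] by simp
      qed
      moreover have "u x \<le> p x" for x
      proof -
        obtain q where "q \<in> C" using False by blast
        then have "q x \<le> p x" using CS by (auto simp: S_def)
        then show ?thesis using u_le[OF \<open>q \<in> C\<close>, of x] by simp
      qed
      ultimately have "u \<in> S" using subu by (auto simp: S_def)
      then show ?thesis using u_le by (auto simp: R_def)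
    qed
  qed
  then obtain q where qS: "q \<in> S" and min: "\<And>q'. q' \<in> S \<Longrightarrow> (\<And>x. q' x \<le> q x) \<Longrightarrow> q' = q"
    unfolding R_def by blast
  have qsub: "q (x + y) \<le> q x + q y" and qdbl: "2 * q x \<le> q (x + x)" and qp: "q x \<le> p x" for x y
    using qS by (auto simp: S_def)
  have qn: "q (real n *\<^sub>R x) = real n * q x" for n x
    using qsub qdbl by (rule subadditive_multiple)
  have "q x + q y \<le> q (x + y)" for x y
  proof -
    define r where "r = (\<lambda>x n. q (x + real n *\<^sub>R y) - real n * q y)"
    define w where "w = (\<lambda>x. INF n. r x n)"
    have bdd: "bdd_below (range (r x))" for x
    proof (rule bdd_belowI[of _ "- q (- x)"])
      fix z assume "z \<in> range (r x)"
      then obtain n where z: "z = r x n" by auto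
      show "- q (- x) \<le> z"
        using qsub[of "x + real n *\<^sub>R y" "-x"] by (simp add: z r_def qn)
    qed
    have w_le: "w x \<le> r x n" for x n
      unfolding w_def using bdd by (rule cINF_lower) simp
    have le_w: "c \<le> w x" if "\<And>n. c \<le> r x n" for c x
      unfolding w_def using that by (intro cINF_greatest) auto
    have subw: "w (a + b) \<le> w a + w b" for a b
    proof -
      have "w (a + b) \<le> r a m + r b n" for m n
      proof -
        have "w (a + b) \<le> r (a + b) (m + n)" by (rule w_le)
        also have "\<dots> \<le> r a m + r b n"
          using qsub[of "a + real m *\<^sub>R y" "b + real n *\<^sub>R y"]
          by (simp add: r_def algebra_simps)
        finally show ?thesis .
      qed
      then have "w (a + b) - r a m \<le> w b" for m
        by (intro le_w) (simp add: algebra_simps)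
      then have "w (a + b) - w b \<le> w a"
        by (intro le_w) (simp add: algebra_simps)
      then show ?thesis by simp
    qed
    have dblw: "2 * w a \<le> w (a + a)" for a
    proof (rule le_w)
      fix n
      \<comment> \<open>Doubling \<open>a + n y\<close> produces one surplus copy of
        \<open>n y\<close>; it is split off by subadditivity and costs exactly
        \<open>n * q y\<close>.\<close>
      have "2 * q (a + real n *\<^sub>R y) \<le> q ((a + a + real n *\<^sub>R y) + real n *\<^sub>R y)"
        using qdbl[of "a + real n *\<^sub>R y"] by (simp add: algebra_simps)
      also have "\<dots> \<le> q (a + a + real n *\<^sub>R y) + real n * q y"
        using qsub[of "a + a + real n *\<^sub>R y" "real n *\<^sub>R y"] by (simp add: qn)
      finally show "2 * w a \<le> r (a + a) n"
        using w_le[of a n] by (simp add: r_def)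
    qed
    have wq: "w a \<le> q a" for a
      using w_le[of a 0] by (simp add: r_def)
    have "w \<in> S"
      using subw dblw order_trans[OF wq qp] by (simp add: S_def)
    \<comment> \<open>Minimality turns \<open>w \<le> q\<close> into equality, and the term of index
      1 in the infimum then gives superadditivity.\<close>
    then have "w = q" using wq by (rule min)
    then show ?thesis
      using w_le[of x 1] by (simp add: r_def)
  qed
  then have "q (x + y) = q x + q y" for x y
    using qsub by (simp add: order_antisym)
  then have "Modules.additive q" by unfold_locales
  then show thesis using qp that by blast
qed

text \<open>The difference quotients of \<open>f\<close> at \<open>z\<close> decrease as the step is
  halved, and their infimum \<open>p\<close> is subadditive and compatible with doubling. An
  additive minorant of \<open>p\<close> is the desired support.\<close>

lemma mid_convex_support:
  fixes f :: "'a::real_normed_vector \<Rightarrow> real"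
  assumes D: "open D" "convex D" and f: "mid_convex_on D f" and z: "z \<in> D"
  obtains a where "Modules.additive a" "\<And>x. x \<in> D \<Longrightarrow> f z + a (x - z) \<le> f x"
proof -
  \<comment> \<open>The guard \<open>P\<close> keeps the points in \<open>D\<close>, since nothing
    is known of \<open>f\<close> elsewhere; \<open>g\<close> is the difference quotient with step
    \<open>1 / 2 ^ k\<close>.\<close>
  define P where "P = (\<lambda>x k. z + (1 / 2 ^ k) *\<^sub>R x \<in> D)"
  define g where "g = (\<lambda>x k. 2 ^ k * (f (z + (1 / 2 ^ k) *\<^sub>R x) - f z))"
  define p where "p = (\<lambda>x. INF k\<in>Collect (P x). g x k)"
  have mc: "f ((1/2) *\<^sub>R (x + y)) \<le> (f x + f y) / 2" if "x \<in> D" "y \<in> D" for x y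
    using f that by (simp add: mid_convex_on_def)
  have P_half: "P x (Suc k)" if "P x k" for x k
  proof -
    have "(1/2) *\<^sub>R (z + (1 / 2 ^ k) *\<^sub>R x) + (1/2) *\<^sub>R z \<in> D"
      using D(2) that z unfolding P_def by (intro convexD) auto
    moreover have "(1/2) *\<^sub>R (z + (1 / 2 ^ k) *\<^sub>R x) + (1/2) *\<^sub>R z = z + (1 / 2 ^ Suc k) *\<^sub>R x"
      by (simp add: scaleR_add_right flip: scaleR_left_distrib)
    ultimately show ?thesis unfolding P_def by metis
  qed
  have g_half: "g x (Suc k) \<le> g x k" if "P x k" for x k
  proof -
    have "(1/2) *\<^sub>R ((z + (1 / 2 ^ k) *\<^sub>R x) + z) = z + (1 / 2 ^ Suc k) *\<^sub>R x"
      by (simp add: scaleR_add_right flip: scaleR_left_distrib)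
    then have "f (z + (1 / 2 ^ Suc k) *\<^sub>R x) \<le> (f (z + (1 / 2 ^ k) *\<^sub>R x) + f z) / 2"
      using mc[of "z + (1 / 2 ^ k) *\<^sub>R x" z] that z by (simp add: P_def)
    then have "2 ^ k * (2 * (f (z + (1 / 2 ^ Suc k) *\<^sub>R x) - f z)) \<le> 2 ^ k * (f (z + (1 / 2 ^ k) *\<^sub>R x) - f z)"
      by (intro mult_left_mono) auto
    then show ?thesis by (simp add: g_def)
  qed
  have mono: "P x (k + j) \<and> g x (k + j) \<le> g x k" if "P x k" for x k j
    using that by (induction j) (auto intro: P_half order_trans[OF g_half])
  have ex: "\<exists>k. P x k" for x
  proof -
    have "(\<lambda>k. z + (1 / 2 ^ k) *\<^sub>R x) \<longlonglongrightarrow> z + 0 *\<^sub>R x"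
      by (intro tendsto_intros LIMSEQ_divide_realpow_zero) auto
    then have "\<forall>\<^sub>F k in sequentially. z + (1 / 2 ^ k) *\<^sub>R x \<in> D"
      using topological_tendstoD[OF _ D(1)] z by force
    then show ?thesis
      unfolding P_def eventually_sequentially by blast
  qed
  have symm: "- g (- x) k \<le> g x k" if "P x k" "P (- x) k" for x k
  proof -
    have "(1/2) *\<^sub>R ((z + (1 / 2 ^ k) *\<^sub>R x) + (z + (1 / 2 ^ k) *\<^sub>R (- x))) = z"
      by (simp add: scaleR_add_right flip: scaleR_left_distrib)
    then have "f z \<le> (f (z + (1 / 2 ^ k) *\<^sub>R x) + f (z + (1 / 2 ^ k) *\<^sub>R (- x))) / 2"
      using mc[of "z + (1 / 2 ^ k) *\<^sub>R x" "z + (1 / 2 ^ k) *\<^sub>R (- x)"] that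
      unfolding P_def by metis
    then have "2 ^ k * (2 * f z) \<le> 2 ^ k * (f (z + (1 / 2 ^ k) *\<^sub>R x) + f (z + (1 / 2 ^ k) *\<^sub>R (- x)))"
      by (intro mult_left_mono) auto
    then show ?thesis unfolding g_def by (simp add: algebra_simps)
  qed
  \<comment> \<open>A single quotient in direction \<open>- x\<close> bounds all those in direction
    \<open>x\<close> from below, once both are moved to the common level \<open>k + m\<close>;
    \<open>symm\<close> compares them there because \<open>z\<close> is the midpoint of opposite
    points.\<close>
  have bdd: "bdd_below (g x ` Collect (P x))" for x
  proof -
    obtain m where m: "P (- x) m" using ex by blast
    have "- g (- x) m \<le> g x k" if "P x k" for k
    proof -
      have "- g (- x) (m + k) \<le> g x (k + m)"
        using symm[of x "k + m"] mono[OF that, of m] mono[OF m, of k] by (simp add: add.commute)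
      then show ?thesis
        using mono[OF that, of m] mono[OF m, of k] by linarith
    qed
    then show ?thesis by (auto simp: bdd_below_def)
  qed
  have p_le: "p x \<le> g x k" if "P x k" for x k
    unfolding p_def using bdd that by (intro cINF_lower) auto
  have le_p: "c \<le> p x" if "\<And>k. P x k \<Longrightarrow> c \<le> g x k" for c x
    unfolding p_def using ex that by (intro cINF_greatest) auto
  \<comment> \<open>Doubling the direction amounts to raising the dyadic level by one.\<close>
  have shift: "P (x + x) (Suc k) = P x k" "g (x + x) (Suc k) = 2 * g x k" for x k
    by (simp_all add: P_def g_def flip: scaleR_2)
  have "p (x + y) \<le> p x + p y" for x y
  proof -
    have "p (x + y) \<le> g x m + g y n" if "P x m" "P y n" for m n
    proof -
      define k where "k = m + n"
      have k: "P x k" "g x k \<le> g x m" "P y k" "g y k \<le> g y n"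
        using mono[OF that(1), of n] mono[OF that(2), of m] by (auto simp: k_def add.commute)
      have eq: "(1/2) *\<^sub>R ((z + (1 / 2 ^ k) *\<^sub>R x) + (z + (1 / 2 ^ k) *\<^sub>R y)) = z + (1 / 2 ^ Suc k) *\<^sub>R (x + y)"
        by (simp add: scaleR_add_right flip: scaleR_left_distrib)
      have "(1/2) *\<^sub>R (z + (1 / 2 ^ k) *\<^sub>R x) + (1/2) *\<^sub>R (z + (1 / 2 ^ k) *\<^sub>R y) \<in> D"
        using D(2) k unfolding P_def by (intro convexD) auto
      then have Pk: "P (x + y) (Suc k)"
        unfolding P_def eq[symmetric] by (simp add: scaleR_add_right)
      have "f (z + (1 / 2 ^ Suc k) *\<^sub>R (x + y)) \<le> (f (z + (1 / 2 ^ k) *\<^sub>R x) + f (z + (1 / 2 ^ k) *\<^sub>R y)) / 2"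
        using mc[of "z + (1 / 2 ^ k) *\<^sub>R x" "z + (1 / 2 ^ k) *\<^sub>R y"] k
        unfolding P_def eq by blast
      then have "2 ^ k * (2 * f (z + (1 / 2 ^ Suc k) *\<^sub>R (x + y))) \<le> 2 ^ k * (f (z + (1 / 2 ^ k) *\<^sub>R x) + f (z + (1 / 2 ^ k) *\<^sub>R y))"
        by (intro mult_left_mono) auto
      then have "g (x + y) (Suc k) \<le> g x k + g y k"
        unfolding g_def by (simp add: algebra_simps)
      then show ?thesis
        using p_le[OF Pk] k by linarith
    qed
    then have "p (x + y) - g x m \<le> p y" if "P x m" for m
      using that by (intro le_p) (simp add: algebra_simps)
    then have "p (x + y) - p y \<le> p x"
      by (intro le_p) (simp add: algebra_simps)
    then show ?thesis by simp
  qed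
  moreover have "2 * p x \<le> p (x + x)" for x
  proof (rule le_p)
    fix k assume "P (x + x) k"
    then have "P (x + x) (Suc k)" "g (x + x) (Suc k) \<le> g (x + x) k"
      using P_half g_half by blast+
    then show "2 * p x \<le> g (x + x) k"
      using p_le[of x k] by (simp add: shift)
  qed
  ultimately obtain a where a: "Modules.additive a" "\<And>x. a x \<le> p x"
    using additive_minorant by blast
  have "f z + a (x - z) \<le> f x" if "x \<in> D" for x
    using p_le[of "x - z" 0] a(2)[of "x - z"] that by (simp add: P_def g_def)
  with a(1) show thesis by (rule that)
qed

text \<open>Additivity gives homogeneity over the rationals, and continuity extends it to their
  closure.\<close>

lemma continuous_additive_scaleR:
  fixes a :: "'a::real_normed_vector \<Rightarrow> real"
  assumes "Modules.additive a" "continuous_on UNIV a"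
  shows "a (c *\<^sub>R x) = c * a x"
proof -
  interpret Modules.additive a by fact
  have nat: "a (real n *\<^sub>R x) = real n * a x" for n x
    by (induction n) (auto simp: zero add algebra_simps)
  have int: "a (real_of_int m *\<^sub>R x) = real_of_int m * a x" for m x
    by (cases m rule: int_cases2) (auto simp: nat minus)
  have rat: "a (q *\<^sub>R x) - q * a x = 0" if q: "q \<in> \<rat>" for q
  proof -
    obtain m n where n: "n > 0" and qq: "q = real_of_int m / real_of_int n"
      using q by (rule Rats_cases')
    have "real_of_int n * a (q *\<^sub>R x) = a (real_of_int n *\<^sub>R q *\<^sub>R x)" by (rule int[symmetric])
    also have "\<dots> = real_of_int m * a x"
      using n by (simp add: qq int)
    finally show ?thesis using n by (simp add: qq field_simps)
  qed
  have "continuous_on (closure \<rat>) (\<lambda>q. a (q *\<^sub>R x) - q * a x)"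
    by (intro continuous_intros continuous_on_compose2[OF assms(2)]) auto
  then have "a (c *\<^sub>R x) - c * a x = 0"
    using continuous_constant_on_closure[of "\<rat>" "\<lambda>q. a (q *\<^sub>R x) - q * a x" 0 c] rat
    by (simp add: Rats_closure_real)
  then show ?thesis by simp
qed

text \<open>Additive functions are mid-convex on the whole space, which gives one inclusion. For the
  other, linear supports at all points of \<open>D\<close> make a mid-convex function
  convex.\<close>

theorem family_A_eq_family_B: "family_A = (family_B :: 'a::euclidean_space set set)"
proof (intro subset_antisym subsetI)
  fix T :: "'a set" assume T: "T \<in> family_A"
  show "T \<in> family_B"
    unfolding family_B_def
  proof (clarsimp)
    fix f :: "'a \<Rightarrow> real" assume f: "Modules.additive f" "bdd_above (f ` T)"
    have "f ((1/2) *\<^sub>R (x + y)) \<le> (f x + f y) / 2" for x y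
      using additive.add[OF f(1), of "(1/2) *\<^sub>R (x + y)" "(1/2) *\<^sub>R (x + y)"] additive.add[OF f(1), of x y]
      by (simp flip: scaleR_left_distrib)
    then have "mid_convex_on UNIV f" by (simp add: mid_convex_on_def)
    then show "continuous_on UNIV f"
      using T f unfolding family_A_def by blast
  qed
next
  fix T :: "'a set" assume T: "T \<in> family_B"
  show "T \<in> family_A"
    unfolding family_A_def
  proof (clarsimp)
    fix D :: "'a set" and f :: "'a \<Rightarrow> real"
    assume D: "open D" "convex D" and TD: "T \<subseteq> D" and f: "mid_convex_on D f" and bdd: "bdd_above (f ` T)"
    obtain M where M: "\<And>x. x \<in> T \<Longrightarrow> f x \<le> M"
      using bdd by (auto simp: bdd_above_def)
    have "convex_on D f"
    proof (intro convex_onI D(2))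
      fix t x y assume t: "0 < t" "t < (1::real)" and xy: "x \<in> D" "y \<in> D"
      define z where "z = (1 - t) *\<^sub>R x + t *\<^sub>R y"
      have zD: "z \<in> D"
        using D(2) t xy unfolding z_def by (intro convexD) auto
      obtain a where a: "Modules.additive a" and sup: "\<And>x. x \<in> D \<Longrightarrow> f z + a (x - z) \<le> f x"
        using mid_convex_support[OF D f zD] by blast
      interpret Modules.additive a by fact
      \<comment> \<open>An upper bound for \<open>f\<close> on \<open>T\<close> is inherited by the
        support, which is therefore continuous by \<open>T \<in> family_B\<close>.\<close>
      have "a x \<le> M - f z + a z" if "x \<in> T" for x
        using sup[of x] M[OF that] TD that diff[of x z] by auto
      then have "bdd_above (a ` T)" by (auto simp: bdd_above_def)
      then have "continuous_on UNIV a"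
        using T a unfolding family_B_def by blast
      note sc = continuous_additive_scaleR[OF a this]
      have "x - z = t *\<^sub>R (x - y)" "y - z = - ((1 - t) *\<^sub>R (x - y))"
        by (simp_all add: z_def algebra_simps)
      then have "f z + t * a (x - y) \<le> f x" "f z - (1 - t) * a (x - y) \<le> f y"
        using sup[OF xy(1)] sup[OF xy(2)] by (simp_all add: minus sc)
      \<comment> \<open>When the two support inequalities are weighted by \<open>1 - t\<close> and
        \<open>t\<close> and added, the terms with \<open>a\<close> cancel.\<close>
      then have "(1 - t) * (f z + t * a (x - y)) \<le> (1 - t) * f x"
          "t * (f z - (1 - t) * a (x - y)) \<le> t * f y"
        using t by (intro mult_left_mono; simp)+
      then show "f ((1 - t) *\<^sub>R x + t *\<^sub>R y) \<le> (1 - t) * f x + t * f y"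
        unfolding z_def[symmetric] by (simp add: algebra_simps)
    qed
    then show "continuous_on D f"
      using D(1) convex_on_continuous by blast
  qed
qed

text \<open>After translation of the ball to the origin, its symmetry turns the upper bound into a
  two-sided one. Shrinking the ball by the factor \<open>n\<close> divides the bound by
  \<open>n\<close>, so \<open>a\<close> is continuous at 0 and hence everywhere.\<close>

lemma additive_bdd_above_ball_continuous:
  fixes a :: "'a::real_normed_vector \<Rightarrow> real"
  assumes "Modules.additive a" and r: "r > 0" and M: "\<And>x. x \<in> ball c r \<Longrightarrow> a x \<le> M"
  shows "continuous_on UNIV a"
proof -
  interpret Modules.additive a by fact
  define B where "B = \<bar>M - a c\<bar> + 1"
  have up: "a x < B" if "norm x < r" for x
    using M[of "c + x"] that by (simp add: B_def dist_norm add)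
  have nat: "a (real n *\<^sub>R x) = real n * a x" for n x
    by (induction n) (auto simp: zero add algebra_simps)
  have small: "\<exists>d>0. \<forall>x. norm x < d \<longrightarrow> \<bar>a x\<bar> < e" if e: "e > 0" for e
  proof -
    obtain n where n: "B / e < real n" using reals_Archimedean2 by blast
    have "B > 0" by (simp add: B_def)
    then have n0: "real n > 0" using n e by (meson divide_pos_pos less_trans)
    have "\<bar>a x\<bar> < e" if x: "norm x < r / real n" for x
    proof -
      have "norm (real n *\<^sub>R x) < r" "norm (real n *\<^sub>R (- x)) < r"
        using x n0 by (simp_all add: field_simps)
      then have "real n * a x < B" "real n * a (- x) < B"
        using up nat by metis+
      then have "real n * \<bar>a x\<bar> < B" by (simp add: minus abs_if)
      also have "B < real n * e" using n e by (simp add: field_simps)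
      finally show ?thesis using n0 by simp
    qed
    then show ?thesis using n0 r by (intro exI[of _ "r / real n"]) auto
  qed
  show ?thesis
    unfolding continuous_on_iff
  proof (clarsimp)
    fix x and e :: real assume "e > 0"
    then obtain d where d: "d > 0" "\<And>x. norm x < d \<Longrightarrow> \<bar>a x\<bar> < e" using small by blast
    then show "\<exists>d>0. \<forall>x'. dist x' x < d \<longrightarrow> dist (a x') (a x) < e"
      by (intro exI[of _ d]) (auto simp: dist_norm simp flip: diff)
  qed
qed

lemma family_B_subset_family_C: "family_B \<subseteq> family_C"
  by (auto simp: family_B_def family_C_def intro: bounded_imp_bdd_above)

section \<open>Meager sets and the Baire property of analytic sets\<close>

lemma nowhere_dense_in_subset:
  "nowhere_dense_in X S \<Longrightarrow> T \<subseteq> S \<Longrightarrow> nowhere_dense_in X T"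
  unfolding nowhere_dense_in_def
  by (metis closure_of_mono interior_of_mono order_trans subset_empty)

lemma nowhere_dense_imp_meager_in: "nowhere_dense_in X S \<Longrightarrow> meager_in X S"
  unfolding meager_in_def by (intro exI[of _ "{S}"]) auto

lemma meager_in_subset:
  assumes "meager_in X S" "T \<subseteq> S"
  shows "meager_in X T"
proof -
  obtain \<N> where \<N>: "countable \<N>" "\<And>N. N \<in> \<N> \<Longrightarrow> nowhere_dense_in X N" "S = \<Union>\<N>"
    using assms(1) unfolding meager_in_def by blast
  show ?thesis
    unfolding meager_in_def
  proof (intro exI[of _ "(\<lambda>N. N \<inter> T) ` \<N>"] conjI ballI)
    show "T = \<Union> ((\<lambda>N. N \<inter> T) ` \<N>)" using \<N>(3) assms(2) by blast
  qed (use \<N> in \<open>auto intro: nowhere_dense_in_subset\<close>)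
qed

lemma meager_in_UN:
  assumes I: "countable I" and S: "\<And>i. i \<in> I \<Longrightarrow> meager_in X (S i)"
  shows "meager_in X (\<Union>i\<in>I. S i)"
proof -
  have "\<forall>i\<in>I. \<exists>\<N>. countable \<N> \<and> (\<forall>N\<in>\<N>. nowhere_dense_in X N) \<and> S i = \<Union>\<N>"
    using S unfolding meager_in_def by blast
  then obtain \<N> where \<N>: "\<And>i. i \<in> I \<Longrightarrow> countable (\<N> i)"
      "\<And>i N. i \<in> I \<Longrightarrow> N \<in> \<N> i \<Longrightarrow> nowhere_dense_in X N" "\<And>i. i \<in> I \<Longrightarrow> S i = \<Union>(\<N> i)"
    by metis
  show ?thesis
    unfolding meager_in_def
    by (intro exI[of _ "\<Union>i\<in>I. \<N> i"]) (use I \<N> in auto)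
qed

lemma meager_in_Un: "meager_in X S \<Longrightarrow> meager_in X T \<Longrightarrow> meager_in X (S \<union> T)"
  using meager_in_UN[of UNIV X "\<lambda>b. if b then S else T"] by (simp add: UNIV_bool Un_commute)

lemma meager_in_empty [simp]: "meager_in X {}"
  unfolding meager_in_def by (intro exI[of _ "{}"]) auto

lemma nowhere_dense_in_euclidean_iff: "nowhere_dense_in euclidean S \<longleftrightarrow> interior (closure S) = {}"
  by (simp add: nowhere_dense_in_def)

text \<open>An open set that meets \<open>closure U\<close> meets \<open>U\<close>, so no non-empty
  one fits into the boundary.\<close>

lemma nowhere_dense_closure_diff_open:
  assumes "open U"
  shows "nowhere_dense_in euclidean (closure U - U)"
proof -
  have "closed (closure U - U)"
    using assms by (intro closed_Diff) auto
  moreover have "interior (closure U - U) \<inter> closure U = {}"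
    using interior_subset[of "closure U - U"] by (subst open_Int_closure_eq_empty) auto
  then have "interior (closure U - U) = {}"
    using interior_subset[of "closure U - U"] by blast
  ultimately show ?thesis
    by (simp add: nowhere_dense_in_euclidean_iff)
qed

lemma nowhere_dense_closed_diff_interior:
  assumes "closed S"
  shows "nowhere_dense_in euclidean (S - interior S)"
proof -
  have "S - interior S = closure (- S) - (- S)"
    by (auto simp: closure_complement)
  with nowhere_dense_closure_diff_open[of "- S"] show ?thesis
    using assms by (simp add: open_Compl)
qed

lemma open_not_meager:
  fixes W :: "'a::euclidean_space set"
  assumes "open W" "W \<noteq> {}"
  shows "\<not> meager_in euclidean W"
proof
  assume "meager_in euclidean W"
  then obtain \<N> where \<N>: "countable \<N>" "\<And>N. N \<in> \<N> \<Longrightarrow> interior (closure N) = {}" "W = \<Union>\<N>"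
    unfolding meager_in_def nowhere_dense_in_euclidean_iff by blast
  have "euclidean interior_of \<Union>(closure ` \<N>) = {}"
    by (rule Baire_category_alt) (use \<N> in \<open>auto intro: completely_metrizable_space_euclidean\<close>)
  moreover have "W \<subseteq> \<Union>(closure ` \<N>)"
    using \<N>(3) closure_subset by fast
  ultimately show False
    using assms interior_maximal[of W "\<Union>(closure ` \<N>)"] by simp
qed

text \<open>The set of points at which \<open>S\<close> is locally of the second category.\<close>

definition nonmeager_points :: "'a::topological_space set \<Rightarrow> 'a set"
  where "nonmeager_points S = {x. \<forall>U. open U \<and> x \<in> U \<longrightarrow> \<not> meager_in euclidean (S \<inter> U)}"

lemma closed_nonmeager_points: "closed (nonmeager_points S)"
proof -
  have "- nonmeager_points S = \<Union>{U. open U \<and> meager_in euclidean (S \<inter> U)}"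
    by (auto simp: nonmeager_points_def)
  then show ?thesis by (metis (mono_tags, lifting) closed_open mem_Collect_eq open_Union)
qed

text \<open>A countable-base form of Banach's category theorem: the points of \<open>S\<close> off
  \<open>nonmeager_points S\<close> lie in countably many basic open sets that meet \<open>S\<close>
  in a meager set. The interior thus serves as an open hull of \<open>S\<close> up to a meager
  set.\<close>

lemma meager_diff_interior_nonmeager_points:
  fixes S :: "'a::second_countable_topology set"
  shows "meager_in euclidean (S - interior (nonmeager_points S))"
proof -
  obtain B :: "'a set set" where B: "countable B" "topological_basis B"
    using ex_countable_basis by blast
  have "meager_in euclidean (\<Union>U\<in>{U\<in>B. meager_in euclidean (S \<inter> U)}. S \<inter> U)"
    using B(1) by (intro meager_in_UN) auto
  moreover have "S - nonmeager_points S \<subseteq> (\<Union>U\<in>{U\<in>B. meager_in euclidean (S \<inter> U)}. S \<inter> U)"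
  proof
    fix x assume x: "x \<in> S - nonmeager_points S"
    then obtain U where "open U" "x \<in> U" and U: "meager_in euclidean (S \<inter> U)"
      by (auto simp: nonmeager_points_def)
    then obtain V where "V \<in> B" "x \<in> V" "V \<subseteq> U"
      using B(2) topological_basisE by metis
    moreover from this have "meager_in euclidean (S \<inter> V)"
      using U by (auto intro: meager_in_subset)
    ultimately show "x \<in> (\<Union>U\<in>{U\<in>B. meager_in euclidean (S \<inter> U)}. S \<inter> U)"
      using x by auto
  qed
  ultimately have "meager_in euclidean (S - nonmeager_points S)"
    by (rule meager_in_subset)
  moreover have "meager_in euclidean (nonmeager_points S - interior (nonmeager_points S))"
    by (intro nowhere_dense_imp_meager_in nowhere_dense_closed_diff_interior closed_nonmeager_points)
  ultimately show ?thesis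
    by (rule meager_in_subset[OF meager_in_Un]) auto
qed

text \<open>Outside the closure of the union \<open>Q\<close> of the hulls of the
  \<open>T i\<close>, the set \<open>S\<close> is meager, so the hull of \<open>S\<close> cannot
  reach there. The difference therefore lies in the boundary of \<open>Q\<close>.\<close>

lemma nowhere_dense_interior_nonmeager_points_diff:
  fixes S :: "'a::second_countable_topology set"
  assumes I: "countable I" and S: "S \<subseteq> (\<Union>i\<in>I. T i)"
  shows "nowhere_dense_in euclidean
    (interior (nonmeager_points S) - (\<Union>i\<in>I. interior (nonmeager_points (T i))))"
proof -
  define Q where "Q = (\<Union>i\<in>I. interior (nonmeager_points (T i)))"
  have "interior (nonmeager_points S) \<subseteq> closure Q"
  proof (rule ccontr)
    assume "\<not> interior (nonmeager_points S) \<subseteq> closure Q"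
    then obtain x where x: "x \<in> nonmeager_points S" "x \<in> - closure Q"
      using interior_subset by blast
    have "meager_in euclidean (\<Union>i\<in>I. T i - interior (nonmeager_points (T i)))"
      using I by (intro meager_in_UN meager_diff_interior_nonmeager_points)
    moreover have "S \<inter> - closure Q \<subseteq> (\<Union>i\<in>I. T i - interior (nonmeager_points (T i)))"
      using S closure_subset[of Q] unfolding Q_def by blast
    ultimately have "meager_in euclidean (S \<inter> - closure Q)"
      by (rule meager_in_subset)
    then show False
      using x open_Compl[OF closed_closure, of Q] unfolding nonmeager_points_def by blast
  qed
  moreover have "open Q" by (auto simp: Q_def)
  ultimately have "interior (nonmeager_points S) - Q \<subseteq> closure Q - Q"
    by blast
  moreover have "nowhere_dense_in euclidean (closure Q - Q)"
    using \<open>open Q\<close> by (rule nowhere_dense_closure_diff_open)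
  ultimately show ?thesis
    unfolding Q_def by (rule nowhere_dense_in_subset[rotated])
qed

text \<open>Nikodym's theorem. A point outside the meager set \<open>N\<close> determines a decreasing sequence of
  small open sets of the Polish space, whose images accumulate at that point.\<close>

lemma analytic_set_Baire_property:
  fixes B :: "'a::{second_countable_topology, metric_space} set"
  assumes "analytic_set B"
  obtains W where "open W" "meager_in euclidean (W - B)" "meager_in euclidean (B - W)"
proof -
  obtain X :: "real topology" and f where X: "Polish_space X" and f: "continuous_map X euclidean f"
    and fB: "f ` topspace X = B"
    using assms unfolding analytic_set_def by blast
  obtain M d where Md: "Metric_space M d" "Metric_space.mcomplete M d" and XM: "X = Metric_space.mtopology M d"
    using X unfolding Polish_space_def completely_metrizable_space_def by blast
  interpret Metric_space M d by fact
  obtain \<B> where \<B>: "countable \<B>" "\<And>V. V \<in> \<B> \<Longrightarrow> openin X V"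
      "\<And>U x. openin X U \<Longrightarrow> x \<in> U \<Longrightarrow> \<exists>V \<in> \<B>. x \<in> V \<and> V \<subseteq> U"
    using X unfolding Polish_space_def second_countable_def by metis
  define I where "I = (\<lambda>V. interior (nonmeager_points (f ` V)))"
  define sub where "sub = (\<lambda>V k. {V' \<in> \<B>. V' \<subseteq> V \<and> (\<exists>c. V' \<subseteq> mball c ((1/2) ^ k))})"
  \<comment> \<open>\<open>N\<close> collects the points lost when the hull \<open>I V\<close> is
    replaced by the hulls of small pieces of \<open>V\<close>. The whole space \<open>M\<close> is
    inserted as the starting point of the recursion.\<close>
  define N where "N = (\<Union>(V, k)\<in>insert M \<B> \<times> (UNIV :: nat set). I V - (\<Union>V'\<in>sub V k. I V'))"
  have cover: "f ` V \<subseteq> (\<Union>V'\<in>sub V k. f ` V')" if "openin X V" for V and k :: nat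
  proof -
    have "\<exists>V'\<in>sub V k. x \<in> V'" if "x \<in> V" for x
    proof -
      have "x \<in> M" using that \<open>openin X V\<close> openin_subset XM by fastforce
      then have "openin X (V \<inter> mball x ((1/2) ^ k))" "x \<in> V \<inter> mball x ((1/2) ^ k)"
        using \<open>openin X V\<close> that by (auto simp: XM)
      then obtain V' where "V' \<in> \<B>" "x \<in> V'" "V' \<subseteq> V \<inter> mball x ((1/2) ^ k)"
        using \<B>(3) by meson
      then show ?thesis unfolding sub_def by blast
    qed
    then show ?thesis by blast
  qed
  have "countable (sub V k)" for V k
    using \<B>(1) by (auto simp: sub_def)
  moreover have openM: "openin X M" by (simp add: XM)
  ultimately have "meager_in euclidean (I V - (\<Union>V'\<in>sub V k. I V'))" if "V \<in> insert M \<B>" for V k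
    unfolding I_def using that \<B>(2)
    by (intro nowhere_dense_imp_meager_in nowhere_dense_interior_nonmeager_points_diff cover) auto
  then have meagerN: "meager_in euclidean N"
    unfolding N_def using \<B>(1) by (intro meager_in_UN) auto
  have IB: "I M = interior (nonmeager_points B)"
    using fB by (simp add: I_def XM)
  have "x \<in> B" if x: "x \<in> I M - N" for x
  proof -
    have "\<exists>V. \<forall>k. (V k \<in> insert M \<B> \<and> x \<in> I (V k)) \<and> V (Suc k) \<in> sub (V k) k"
    proof (rule dependent_nat_choice)
      show "\<exists>V. V \<in> insert M \<B> \<and> x \<in> I V" using x by blast
    next
      fix V k assume V: "V \<in> insert M \<B> \<and> x \<in> I V"
      then have "x \<in> (\<Union>V'\<in>sub V k. I V')"
        using x unfolding N_def by blast
      then show "\<exists>V'. (V' \<in> insert M \<B> \<and> x \<in> I V') \<and> V' \<in> sub V k"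
        unfolding sub_def by blast
    qed
    then obtain V where V: "\<And>k. V k \<in> insert M \<B>" "\<And>k. x \<in> I (V k)" "\<And>k. V (Suc k) \<in> sub (V k) k"
      by blast
    have dec: "V (k + j) \<subseteq> V k" for k j
      using V(3) by (induction j) (auto simp: sub_def)
    have VM: "V k \<subseteq> M" for k
      using V(1)[of k] \<B>(2) openin_subset[of X] by (auto simp: XM)
    \<comment> \<open>A point of the hull has the image of \<open>V k\<close> non-meager in each
      ball around it, in particular non-empty there.\<close>
    have "\<exists>p \<in> V k. dist (f p) x < 1 / real (Suc k)" for k
    proof -
      have "x \<in> nonmeager_points (f ` V k)"
        using V(2)[of k] interior_subset unfolding I_def by blast
      then have "\<not> meager_in euclidean (f ` V k \<inter> ball x (1 / real (Suc k)))"
        unfolding nonmeager_points_def by simp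
      then have "f ` V k \<inter> ball x (1 / real (Suc k)) \<noteq> {}"
        by (metis meager_in_empty)
      then show ?thesis by (auto simp: dist_commute)
    qed
    then obtain p where p: "\<And>k. p k \<in> V k" "\<And>k. dist (f (p k)) x < 1 / real (Suc k)"
      by metis
    have "MCauchy p"
      unfolding MCauchy_def
    proof (intro conjI allI impI)
      show "range p \<subseteq> M" using p(1) VM by blast
    next
      fix e :: real assume "e > 0"
      then obtain k where k: "(1/2) ^ k < e / 2"
        using real_arch_pow_inv[of "e/2" "1/2"] by auto
      \<comment> \<open>The constraint on \<open>V (Suc k)\<close> carries the radius of level
        \<open>k\<close>, so the common ball is available from index \<open>Suc k\<close>
        on.\<close>
      obtain c where c: "V (Suc k) \<subseteq> mball c ((1/2) ^ k)"
        using V(3)[of k] by (auto simp: sub_def)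
      have "d (p n) (p n') < e" if "n \<ge> Suc k" "n' \<ge> Suc k" for n n'
      proof -
        have "p n \<in> mball c ((1/2) ^ k)" "p n' \<in> mball c ((1/2) ^ k)"
          using p(1) dec[of "Suc k" "n - Suc k"] dec[of "Suc k" "n' - Suc k"] that c by force+
        then show ?thesis
          using k triangle''[of "p n" "p n'" c] triangle[of "p n" c "p n'"] by (auto simp: commute)
      qed
      then show "\<exists>N. \<forall>n n'. N \<le> n \<longrightarrow> N \<le> n' \<longrightarrow> d (p n) (p n') < e" by blast
    qed
    then obtain l where l: "limitin X p l sequentially"
      using Md(2) unfolding mcomplete_def XM by blast
    then have "l \<in> M"
      by (simp add: XM limitin_mspace)
    have "(f \<circ> p) \<longlonglongrightarrow> f l"
      using continuous_map_limit[OF f l] by simp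
    moreover have "(f \<circ> p) \<longlonglongrightarrow> x"
    proof (rule metric_tendsto_imp_tendsto)
      show "(\<lambda>k. 1 / real (Suc k)) \<longlonglongrightarrow> 0"
        using LIMSEQ_inverse_real_of_nat by (simp add: inverse_eq_divide)
      show "\<forall>\<^sub>F k in sequentially. dist ((f \<circ> p) k) x \<le> dist (1 / real (Suc k)) 0"
        using p(2) by (auto intro!: always_eventually less_imp_le)
    qed
    ultimately have "x = f l" using LIMSEQ_unique by blast
    then show ?thesis using fB \<open>l \<in> M\<close> by (auto simp: XM)
  qed
  then have "interior (nonmeager_points B) - B \<subseteq> N" unfolding IB by blast
  then have "meager_in euclidean (interior (nonmeager_points B) - B)"
    using meagerN meager_in_subset by blast
  with that[of "interior (nonmeager_points B)"] show thesis
    by (simp add: meager_diff_interior_nonmeager_points)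
qed

section \<open>Sum sets and difference sets of non-meager analytic sets\<close>

lemma meager_in_homeomorphic_image:
  assumes h: "homeomorphic_map X Y h" and S: "meager_in X S"
  shows "meager_in Y (h ` S)"
proof -
  obtain \<N> where \<N>: "countable \<N>" "\<And>N. N \<in> \<N> \<Longrightarrow> nowhere_dense_in X N" "S = \<Union>\<N>"
    using S unfolding meager_in_def by blast
  have "nowhere_dense_in Y (h ` N)" if "N \<in> \<N>" for N
    using \<N>(2)[OF that] homeomorphic_map_closure_of[OF h, of N] homeomorphic_map_interior_of[OF h, of "X closure_of N"]
      homeomorphic_imp_surjective_map[OF h] closure_of_subset_topspace[of X N]
    unfolding nowhere_dense_in_def by (metis image_empty image_mono)
  then show ?thesis
    unfolding meager_in_def by (intro exI[of _ "(`) h ` \<N>"]) (use \<N> in auto)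
qed

text \<open>The points of \<open>W\<close> that the affinity sends into \<open>W\<close> form a
  non-empty open set. If no such point worked, this set would be covered by \<open>W - B\<close> and
  its preimage under the affinity, both meager.\<close>

lemma comeager_affinity_meets:
  fixes W :: "'a::euclidean_space set"
  assumes W: "open W" "meager_in euclidean (W - B)" and s: "s \<noteq> 0"
    and z: "z \<in> W" "c + s *\<^sub>R z \<in> W"
  obtains x where "x \<in> B" "c + s *\<^sub>R x \<in> B"
proof (rule ccontr)
  assume neg: "\<not> thesis"
  define h where "h = (\<lambda>x. c + s *\<^sub>R x)"
  define g where "g = (\<lambda>x. (1 / s) *\<^sub>R (x - c))"
  have gh: "g (h x) = x" and hg: "h (g x) = x" for x
    using s by (auto simp: g_def h_def)
  have cont: "continuous_on UNIV g" "continuous_on UNIV h"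
    unfolding g_def h_def by (intro continuous_intros)+
  then have "homeomorphic_maps euclidean euclidean g h"
    by (simp add: homeomorphic_maps_def gh hg)
  then have g: "homeomorphic_map euclidean euclidean g"
    using homeomorphic_maps_map by blast
  have "open (W \<inter> h -` W)"
    using cont(2) W(1) by (intro open_Int open_vimage) auto
  moreover have "W \<inter> h -` W \<noteq> {}"
    using z by (auto simp: h_def)
  moreover have "W \<inter> h -` W \<subseteq> (W - B) \<union> g ` (W - B)"
  proof
    fix x assume x: "x \<in> W \<inter> h -` W"
    show "x \<in> (W - B) \<union> g ` (W - B)"
    proof (cases "x \<in> B")
      case True
      then have "h x \<notin> B" using neg that by (auto simp: h_def)
      then have "g (h x) \<in> g ` (W - B)" using x by blast
      then show ?thesis by (simp add: gh)
    qed (use x in auto)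
  qed
  ultimately show False
    using meager_in_subset[OF meager_in_Un[OF W(2) meager_in_homeomorphic_image[OF g W(2)]]]
      open_not_meager by blast
qed

text \<open>By the Baire property, \<open>B\<close> is comeager in some non-empty open
  \<open>W\<close>. For \<open>z\<close> and \<open>w\<close> in \<open>W\<close>, the reflection in
  their midpoint writes \<open>w + z\<close> as a sum, and the translation by \<open>w - z\<close>
  writes \<open>z - w\<close> as a difference; both maps send \<open>z\<close> to
  \<open>w\<close>.\<close>

lemma Piccard_Pettis:
  fixes B :: "'a::euclidean_space set"
  assumes "analytic_set B" "\<not> meager_in euclidean B"
  shows "interior {x + y |x y. x \<in> B \<and> y \<in> B} \<noteq> {}" "0 \<in> interior {x - y |x y. x \<in> B \<and> y \<in> B}"
proof -
  obtain W where W: "open W" "meager_in euclidean (W - B)" "meager_in euclidean (B - W)"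
    using analytic_set_Baire_property[OF assms(1)] by blast
  have "W \<noteq> {}" using W(3) assms(2) by auto
  then obtain w where w: "w \<in> W" by blast
  have "(+) w ` W \<subseteq> {x + y |x y. x \<in> B \<and> y \<in> B}"
  proof clarsimp
    fix z assume "z \<in> W"
    then obtain x where "x \<in> B" "(w + z) + (-1) *\<^sub>R x \<in> B"
      using comeager_affinity_meets[OF W(1,2), of "-1" w "w + z"] w by auto
    then show "\<exists>x y. w + z = x + y \<and> x \<in> B \<and> y \<in> B"
      by (intro exI[of _ x] exI[of _ "w + z - x"]) auto
  qed
  then show "interior {x + y |x y. x \<in> B \<and> y \<in> B} \<noteq> {}"
    using interior_maximal[OF _ open_translation[OF W(1)]] w by blast
  have "(\<lambda>z. z - w) ` W \<subseteq> {x - y |x y. x \<in> B \<and> y \<in> B}"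
  proof clarsimp
    fix z assume "z \<in> W"
    then obtain x where "x \<in> B" "(w - z) + 1 *\<^sub>R x \<in> B"
      using comeager_affinity_meets[OF W(1,2), of 1 z "w - z"] w by auto
    then show "\<exists>x y. z - w = x - y \<and> x \<in> B \<and> y \<in> B"
      by (intro exI[of _ x] exI[of _ "w - z + x"]) auto
  qed
  moreover have "0 \<in> (\<lambda>z. z - w) ` W" using w by auto
  ultimately show "0 \<in> interior {x - y |x y. x \<in> B \<and> y \<in> B}"
    using interior_maximal[OF _ open_translation_subtract[OF W(1)]] by blast
qed

section \<open>Stability of analytic sets under sums\<close>

lemma second_countable_prod_topology:
  assumes "second_countable X" "second_countable Y"
  shows "second_countable (prod_topology X Y)"
proof -
  obtain \<A> where \<A>: "countable \<A>" "\<And>V. V \<in> \<A> \<Longrightarrow> openin X V"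
      "\<And>U x. openin X U \<Longrightarrow> x \<in> U \<Longrightarrow> \<exists>V \<in> \<A>. x \<in> V \<and> V \<subseteq> U"
    using assms(1) unfolding second_countable_def by metis
  obtain \<B> where \<B>: "countable \<B>" "\<And>V. V \<in> \<B> \<Longrightarrow> openin Y V"
      "\<And>U x. openin Y U \<Longrightarrow> x \<in> U \<Longrightarrow> \<exists>V \<in> \<B>. x \<in> V \<and> V \<subseteq> U"
    using assms(2) unfolding second_countable_def by metis
  show ?thesis
    unfolding second_countable_def
  proof (intro exI[of _ "(\<lambda>(U, V). U \<times> V) ` (\<A> \<times> \<B>)"] conjI ballI allI impI)
    fix U z assume U: "openin (prod_topology X Y) U \<and> z \<in> U"
    obtain x y where z: "z = (x, y)" by (cases z)
    then obtain P Q where PQ: "openin X P" "openin Y Q" "x \<in> P" "y \<in> Q" "P \<times> Q \<subseteq> U"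
      using U unfolding openin_prod_topology_alt by meson
    obtain P' Q' where "P' \<in> \<A>" "x \<in> P'" "P' \<subseteq> P" "Q' \<in> \<B>" "y \<in> Q'" "Q' \<subseteq> Q"
      using \<A>(3)[OF PQ(1,3)] \<B>(3)[OF PQ(2,4)] by blast
    then show "\<exists>V\<in>(\<lambda>(U, V). U \<times> V) ` (\<A> \<times> \<B>). z \<in> V \<and> V \<subseteq> U"
      using PQ(5) z by (intro bexI[of _ "P' \<times> Q'"]) auto
  qed (use \<A> \<B> in \<open>auto simp: openin_prod_Times_iff\<close>)
qed

lemma analytic_set_sums:
  fixes A B :: "'a::real_normed_vector set"
  assumes "analytic_set A" "analytic_set B"
  shows "analytic_set {x + y |x y. x \<in> A \<and> y \<in> B}"
proof -
  obtain X :: "real topology" and f where X: "Polish_space X" "continuous_map X euclidean f" "f ` topspace X = A"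
    using assms(1) unfolding analytic_set_def by blast
  obtain Y :: "real topology" and g where Y: "Polish_space Y" "continuous_map Y euclidean g" "g ` topspace Y = B"
    using assms(2) unfolding analytic_set_def by blast
  have "Polish_space (prod_topology X Y)"
    using X(1) Y(1) by (auto simp: Polish_space_def completely_metrizable_space_prod_topology second_countable_prod_topology)
  moreover have "continuous_map (prod_topology X Y) euclidean (\<lambda>z. f (fst z) + g (snd z))"
    using continuous_map_compose[OF continuous_map_fst X(2), of Y] continuous_map_compose[OF continuous_map_snd Y(2), of X]
    by (intro continuous_map_add) (auto simp: o_def)
  \<comment> \<open>The product has pairs of reals as points, so the version for Polish spaces over
    an arbitrary type is needed here.\<close>
  ultimately have "analytic_set ((\<lambda>z. f (fst z) + g (snd z)) ` topspace (prod_topology X Y))"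
    by (rule analytic_set_continuous_image)
  moreover have "(\<lambda>z. f (fst z) + g (snd z)) ` topspace (prod_topology X Y) = {x + y |x y. x \<in> A \<and> y \<in> B}"
    unfolding X(3)[symmetric] Y(3)[symmetric] by (fastforce simp: image_iff)
  ultimately show ?thesis by simp
qed

text \<open>Needed for the 0-fold sum, where the induction on the number of summands starts.\<close>

lemma analytic_set_singleton: "analytic_set {a}"
proof -
  have "Polish_space (top_of_set {0::real})"
    unfolding Polish_space_def
  proof
    show "completely_metrizable_space (top_of_set {0::real})"
      by (intro completely_metrizable_space_closedin[OF completely_metrizable_space_euclidean]) simp
    show "second_countable (top_of_set {0::real})"
      unfolding second_countable_def
      by (intro exI[of _ "{{0}}"]) (auto simp: openin_subtopology)
  qed
  moreover have "continuous_map (top_of_set {0::real}) euclidean (\<lambda>_. a)" by simp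
  ultimately have "analytic_set ((\<lambda>_. a) ` topspace (top_of_set {0::real}))"
    by (rule analytic_set_continuous_image)
  then show ?thesis by simp
qed

section \<open>Sums of continua\<close>

text \<open>The translates of a path by the multiples of its displacement form a line close to a straight
  one; its continuity is checked on the circle, where the difference becomes a loop.\<close>

lemma path_periodic_extension:
  fixes p :: "real \<Rightarrow> 'a::real_normed_vector"
  assumes p: "path p"
  obtains \<gamma> where "continuous_on UNIV \<gamma>"
    "\<And>t. \<exists>s\<in>{0..1}. \<exists>m::int. \<gamma> t = p s + of_int m *\<^sub>R (p 1 - p 0)"
    "bounded (range (\<lambda>t. \<gamma> t - t *\<^sub>R (p 1 - p 0)))"
proof -
  define e where "e = p 1 - p 0"
  \<comment> \<open>Removing the linear drift makes the endpoints agree.\<close>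
  define g where "g = (\<lambda>s. p s - s *\<^sub>R e)"
  have pathg: "path g"
    using p unfolding path_def g_def by (intro continuous_intros)
  have "pathfinish g = pathstart g"
    by (simp add: pathfinish_def pathstart_def g_def e_def)
  then have "homotopic_loops UNIV g g"
    using pathg by (simp add: homotopic_loops_refl)
  then have "continuous_on (sphere 0 1) (g \<circ> (\<lambda>z. Arg2pi z / (2 * pi)))"
    using homotopic_loops_imp_homotopic_circlemaps homotopic_with_imp_continuous by blast
  \<comment> \<open>\<open>\<sigma> t\<close> is the fractional part of \<open>t\<close>, read off
    as an angle. It jumps at the integers, but its composite with the loop \<open>g\<close> does
    not.\<close>
  moreover define \<sigma> where "\<sigma> = (\<lambda>t. Arg2pi (cis (2 * pi * t)) / (2 * pi))"
  ultimately have cont: "continuous_on UNIV (\<lambda>t. g (\<sigma> t))"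
    using continuous_on_compose2[where f = "\<lambda>t. cis (2 * pi * t)" and s = UNIV]
    by (fastforce simp: o_def intro!: continuous_intros)
  have \<sigma>01: "\<sigma> t \<in> {0..1}" for t
    using Arg2pi[of "cis (2 * pi * t)"] by (auto simp: \<sigma>_def field_simps)
  have \<sigma>int: "\<exists>m::int. t = \<sigma> t + of_int m" for t
  proof -
    have "exp (\<i> * of_real (2 * pi * t)) = exp (\<i> * of_real (2 * pi * \<sigma> t))"
      using Arg2pi_eq[of "cis (2 * pi * t)"] by (simp add: \<sigma>_def cis_conv_exp)
    then obtain n :: int where "\<i> * of_real (2 * pi * t) = \<i> * of_real (2 * pi * \<sigma> t) + (of_int (2 * n) * pi) * \<i>"
      unfolding exp_eq by blast
    then have "2 * pi * t = 2 * pi * \<sigma> t + of_int (2 * n) * pi"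
      by (auto dest: arg_cong[where f = Im])
    then have "2 * pi * t = 2 * pi * (\<sigma> t + of_int n)"
      by (simp add: algebra_simps)
    then have "t = \<sigma> t + of_int n"
      by simp
    then show ?thesis by blast
  qed
  show thesis
  proof
    show "continuous_on UNIV (\<lambda>t. g (\<sigma> t) + t *\<^sub>R e)"
      by (intro continuous_intros cont)
    show "\<exists>s\<in>{0..1}. \<exists>m::int. g (\<sigma> t) + t *\<^sub>R e = p s + of_int m *\<^sub>R (p 1 - p 0)" for t
    proof -
      obtain m :: int where "t = \<sigma> t + of_int m" using \<sigma>int by blast
      then have "t *\<^sub>R e = \<sigma> t *\<^sub>R e + of_int m *\<^sub>R e" by (metis scaleR_left_distrib)
      then have "g (\<sigma> t) + t *\<^sub>R e = p (\<sigma> t) + of_int m *\<^sub>R (p 1 - p 0)"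
        by (simp add: g_def flip: e_def)
      then show ?thesis using \<sigma>01 by blast
    qed
    have "bounded (path_image g)" using pathg by (rule bounded_path_image)
    moreover have "range (\<lambda>t. g (\<sigma> t) + t *\<^sub>R e - t *\<^sub>R (p 1 - p 0)) \<subseteq> path_image g"
      using \<sigma>01 by (auto simp: path_image_def e_def)
    ultimately show "bounded (range (\<lambda>t. g (\<sigma> t) + t *\<^sub>R e - t *\<^sub>R (p 1 - p 0)))"
      by (rule bounded_subset)
  qed
qed

text \<open>Solving \<open>F x = y\<close> means finding a fixed point of \<open>x\<close> mapped to
  \<open>L' (y - (F x - L x))\<close>. This map has bounded range, so Brouwer's theorem applies on a
  large ball.\<close>

lemma surj_bounded_perturbation_linear:
  fixes F L :: "'a::euclidean_space \<Rightarrow> 'a"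
  assumes F: "continuous_on UNIV F" and L: "linear L" "inj L"
    and bdd: "bounded (range (\<lambda>t. F t - L t))"
  shows "surj F"
proof -
  obtain L' where L': "linear L'" "\<And>x. L (L' x) = x"
    using linear_injective_isomorphism[OF L] by blast
  have "\<exists>x. F x = y" for y
  proof -
    define g where "g = (\<lambda>t. L' (y - (F t - L t)))"
    have "bounded (range (\<lambda>t. y - (F t - L t)))"
      using bounded_translation[OF bounded_uminus[THEN iffD2, OF bdd], of y]
      by (simp add: image_image add_diff_eq diff_diff_eq2)
    then have "bounded (L' ` range (\<lambda>t. y - (F t - L t)))"
      by (rule bounded_linear_image[OF _ linear_conv_bounded_linear[THEN iffD1, OF L'(1)]])
    then obtain R where R: "R > 0" "range g \<subseteq> cball 0 R"
      unfolding bounded_pos g_def by fastforce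
    have "continuous_on UNIV g"
      unfolding g_def
      by (intro continuous_on_compose2[OF linear_continuous_on[OF linear_conv_bounded_linear[THEN iffD1, OF L'(1)], of UNIV]]
          continuous_intros F linear_continuous_on[OF linear_conv_bounded_linear[THEN iffD1, OF L(1)]]) auto
    then have "continuous_on (cball 0 R) g"
      by (rule continuous_on_subset) simp
    moreover have "g \<in> cball 0 R \<rightarrow> cball 0 R"
      using R(2) by blast
    ultimately obtain x where "g x = x"
      using brouwer_ball[OF R(1)] by metis
    then have "L x = y - (F x - L x)"
      using L'(2) unfolding g_def by metis
    then show ?thesis by (intro exI[of _ x]) simp
  qed
  then show ?thesis by (metis surj_def)
qed

text \<open>Here connectedness enters: in every neighbourhood of \<open>K i\<close> there is a path from \<open>a i\<close> to
  \<open>b i\<close>, so that the previous two lemmas apply to the sum of the extended paths.\<close>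

lemma sum_of_connected_lattice_dense:
  fixes K :: "'n::finite \<Rightarrow> (real ^ 'n) set" and a b :: "'n \<Rightarrow> real ^ 'n"
  assumes conn: "\<And>i. connected (K i)" and ab: "\<And>i. a i \<in> K i" "\<And>i. b i \<in> K i"
    and inj: "inj (\<lambda>t::real ^ 'n. \<Sum>i\<in>UNIV. t $ i *\<^sub>R (b i - a i))" and \<epsilon>: "\<epsilon> > 0"
  shows "\<exists>x (m :: 'n \<Rightarrow> int). (\<forall>i. x i \<in> K i) \<and> dist ((\<Sum>i\<in>UNIV. x i) + (\<Sum>i\<in>UNIV. of_int (m i) *\<^sub>R (b i - a i))) y < \<epsilon>"
proof -
  \<comment> \<open>One error below \<open>\<delta>\<close> is allowed for each of the
    \<open>CARD('n)\<close> summands.\<close>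
  define \<delta> where "\<delta> = \<epsilon> / real CARD('n)"
  have \<delta>: "\<delta> > 0" using \<epsilon> by (simp add: \<delta>_def)
  define L where "L = (\<lambda>t::real ^ 'n. \<Sum>i\<in>UNIV. t $ i *\<^sub>R (b i - a i))"
  have L: "linear L"
    unfolding L_def by (intro linear_compose_sum ballI) (simp add: linear_iff scaleR_left_distrib)
  \<comment> \<open>The neighbourhood of \<open>K i\<close> of radius \<open>\<delta>\<close> is
    open and connected, hence path-connected, although \<open>K i\<close> itself need not
    be.\<close>
  define U where "U = (\<lambda>i. (\<lambda>z. fst z + snd z) ` (K i \<times> ball 0 \<delta>))"
  have "path_connected (U i)" for i
  proof (rule connected_open_path_connected)
    have "U i = (\<Union>x\<in>K i. \<Union>y\<in>ball 0 \<delta>. {x + y})" by (force simp: U_def)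
    then show "open (U i)" using open_sums[of "K i" "ball 0 \<delta>"] by simp
    show "connected (U i)"
      unfolding U_def
      by (intro connected_continuous_image connected_Times conn continuous_intros) simp
  qed
  moreover have KU: "K i \<subseteq> U i" for i
    using \<delta> by (force simp: U_def)
  ultimately have "\<exists>p. path p \<and> path_image p \<subseteq> U i \<and> pathstart p = a i \<and> pathfinish p = b i" for i
    using ab unfolding path_connected_def by (meson subsetD)
  then obtain p where p: "\<And>i. path (p i)" "\<And>i. path_image (p i) \<subseteq> U i" "\<And>i. p i 0 = a i" "\<And>i. p i 1 = b i"
    unfolding pathstart_def pathfinish_def by metis
  have "\<exists>\<gamma>. continuous_on UNIV \<gamma> \<and> (\<forall>t. \<exists>s\<in>{0..1}. \<exists>m::int. \<gamma> t = p i s + of_int m *\<^sub>R (b i - a i))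
      \<and> bounded (range (\<lambda>t. \<gamma> t - t *\<^sub>R (b i - a i)))" for i
    by (rule path_periodic_extension[OF p(1)[of i]], unfold p(3,4)) blast
  then have "\<exists>\<gamma>. \<forall>i. continuous_on UNIV (\<gamma> i) \<and> (\<forall>t. \<exists>s\<in>{0..1}. \<exists>m::int. \<gamma> i t = p i s + of_int m *\<^sub>R (b i - a i))
      \<and> bounded (range (\<lambda>t. \<gamma> i t - t *\<^sub>R (b i - a i)))"
    by (intro choice allI)
  then obtain \<gamma> where \<gamma>: "\<And>i. continuous_on UNIV (\<gamma> i)"
      "\<And>i t. \<exists>s\<in>{0..1}. \<exists>m::int. \<gamma> i t = p i s + of_int m *\<^sub>R (b i - a i)"
      "\<And>i. bounded (range (\<lambda>t. \<gamma> i t - t *\<^sub>R (b i - a i)))"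
    by blast
  \<comment> \<open>Each coordinate of \<open>t\<close> drives its own extended path, so
    \<open>F\<close> stays within bounded distance of the linear map \<open>L\<close>.\<close>
  define F where "F = (\<lambda>t::real ^ 'n. \<Sum>i\<in>UNIV. \<gamma> i (t $ i))"
  have "surj F"
  proof (rule surj_bounded_perturbation_linear[OF _ L])
    show "continuous_on UNIV F"
      unfolding F_def by (intro continuous_on_sum continuous_on_compose2[OF \<gamma>(1)] continuous_intros) auto
    show "inj L" using inj by (simp add: L_def)
    obtain B where B: "\<And>i t. norm (\<gamma> i t - t *\<^sub>R (b i - a i)) \<le> B i"
      using \<gamma>(3) unfolding bounded_iff by (metis rangeI)
    have "norm (F t - L t) \<le> (\<Sum>i\<in>UNIV. B i)" for t
      unfolding F_def L_def sum_subtractf[symmetric] by (intro sum_norm_le B)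
    then show "bounded (range (\<lambda>t. F t - L t))"
      by (auto simp: bounded_iff)
  qed
  then obtain t where t: "y = F t" by (meson surjD)
  \<comment> \<open>The point on the extended path is a lattice translate of a point of
    \<open>U i\<close>, which is replaced by a nearby point of \<open>K i\<close>.\<close>
  have "\<exists>x (m::int). x \<in> K i \<and> norm (\<gamma> i (t $ i) - (x + of_int m *\<^sub>R (b i - a i))) < \<delta>" for i
  proof -
    obtain s and m :: int where s: "s \<in> {0..1}" "\<gamma> i (t $ i) = p i s + of_int m *\<^sub>R (b i - a i)"
      using \<gamma>(2) by blast
    then have "p i s \<in> U i" using p(2)[of i] by (auto simp: path_image_def)
    then obtain x where "x \<in> K i" "norm (p i s - x) < \<delta>" by (auto simp: U_def)
    then show ?thesis using s by (intro exI[of _ x] exI[of _ m]) (simp add: algebra_simps)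
  qed
  then obtain x and m :: "'n \<Rightarrow> int" where x: "\<And>i. x i \<in> K i"
      and m: "\<And>i. norm (\<gamma> i (t $ i) - (x i + of_int (m i) *\<^sub>R (b i - a i))) < \<delta>"
    by metis
  have "norm (F t - (\<Sum>i\<in>UNIV. x i + of_int (m i) *\<^sub>R (b i - a i)))
      \<le> (\<Sum>i\<in>UNIV. norm (\<gamma> i (t $ i) - (x i + of_int (m i) *\<^sub>R (b i - a i))))"
    unfolding F_def sum_subtractf[symmetric] by (rule norm_sum)
  also have "\<dots> < (\<Sum>i\<in>(UNIV::'n set). \<delta>)"
    using m by (intro sum_strict_mono) auto
  finally have "dist ((\<Sum>i\<in>UNIV. x i) + (\<Sum>i\<in>UNIV. of_int (m i) *\<^sub>R (b i - a i))) y < \<epsilon>"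
    by (simp add: t \<delta>_def sum.distrib dist_norm norm_minus_commute)
  with x show ?thesis by blast
qed

text \<open>The translates of the compact sum by the lattice have a closed union, which is dense by
  the preceding lemma and so is the whole space. By Baire's theorem, countably many nowhere dense
  translates could not cover it.\<close>

lemma sum_of_continua_interior:
  fixes K :: "'n::finite \<Rightarrow> (real ^ 'n) set" and a b :: "'n \<Rightarrow> real ^ 'n"
  assumes K: "\<And>i. compact (K i)" "\<And>i. connected (K i)" and ab: "\<And>i. a i \<in> K i" "\<And>i. b i \<in> K i"
    and inj: "inj (\<lambda>t::real ^ 'n. \<Sum>i\<in>UNIV. t $ i *\<^sub>R (b i - a i))"
  shows "interior {\<Sum>i\<in>UNIV. x i | x. \<forall>i. x i \<in> K i} \<noteq> {}"
proof
  define S where "S = {\<Sum>i\<in>UNIV. x i | x. \<forall>i. x i \<in> K i}"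
  define L where "L = (\<lambda>t::real ^ 'n. \<Sum>i\<in>UNIV. t $ i *\<^sub>R (b i - a i))"
  \<comment> \<open>The lattice is taken as an injective linear image of the integer vectors, which
    makes it closed and countable.\<close>
  define \<Lambda> where "\<Lambda> = L ` {t. \<forall>i. t $ i \<in> \<int>}"
  assume empty: "interior {\<Sum>i\<in>UNIV. x i | x. \<forall>i. x i \<in> K i} = {}"
  have "compact S"
  proof -
    have "compact {\<Sum>i\<in>I. x i | x. \<forall>i\<in>I. x i \<in> K i}" if "finite I" for I
      using that
    proof induction
      case (insert j I)
      have "{\<Sum>i\<in>insert j I. x i | x. \<forall>i\<in>insert j I. x i \<in> K i}
          = {u + v |u v. u \<in> K j \<and> v \<in> {\<Sum>i\<in>I. x i | x. \<forall>i\<in>I. x i \<in> K i}}" (is "?l = ?r")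
      proof (intro subset_antisym subsetI)
        fix w assume "w \<in> ?r"
        then obtain u x where w: "w = u + (\<Sum>i\<in>I. x i)" "u \<in> K j" "\<forall>i\<in>I. x i \<in> K i" by blast
        have "(\<Sum>i\<in>insert j I. (x(j := u)) i) = w"
          using insert.hyps w(1) by (auto intro!: sum.cong)
        then show "w \<in> ?l"
          using w by (intro CollectI exI[of _ "x(j := u)"]) auto
      qed (use insert.hyps in auto)
      then show ?case
        using compact_sums[OF K(1) insert.IH] by simp
    qed (simp add: setcompr_eq_image)
    from this[of UNIV] show ?thesis by (simp add: S_def)
  qed
  have L: "linear L"
    unfolding L_def by (intro linear_compose_sum ballI) (simp add: linear_iff scaleR_left_distrib)
  have "closed {t::real ^ 'n. \<forall>i. t $ i \<in> \<int>}"
    by (intro closed_Collect_all) (auto intro!: closed_vimage[of \<int> "\<lambda>t. t $ _", unfolded vimage_def] continuous_intros)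
  then have "closed \<Lambda>"
    using L inj unfolding \<Lambda>_def L_def by (intro closed_injective_linear_image)
  then have "closed (\<Union>v\<in>\<Lambda>. \<Union>x\<in>S. {v + x})"
    using \<open>compact S\<close> by (rule closed_compact_sums)
  moreover have "y \<in> closure (\<Union>v\<in>\<Lambda>. \<Union>x\<in>S. {v + x})" for y
    unfolding closure_approachable
  proof (intro allI impI)
    fix \<epsilon> :: real assume "\<epsilon> > 0"
    then obtain x and m :: "'n \<Rightarrow> int" where x: "\<forall>i. x i \<in> K i"
      and d: "dist ((\<Sum>i\<in>UNIV. x i) + (\<Sum>i\<in>UNIV. of_int (m i) *\<^sub>R (b i - a i))) y < \<epsilon>"
      using sum_of_connected_lattice_dense[OF K(2) ab inj] by blast
    have "(\<Sum>i\<in>UNIV. of_int (m i) *\<^sub>R (b i - a i)) \<in> \<Lambda>"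
      unfolding \<Lambda>_def L_def by (intro image_eqI[of _ _ "\<chi> i. of_int (m i)"]) auto
    moreover have "(\<Sum>i\<in>UNIV. x i) \<in> S" using x by (auto simp: S_def)
    ultimately have "(\<Sum>i\<in>UNIV. of_int (m i) *\<^sub>R (b i - a i)) + (\<Sum>i\<in>UNIV. x i) \<in> (\<Union>v\<in>\<Lambda>. \<Union>x\<in>S. {v + x})"
      by blast
    then show "\<exists>z\<in>\<Union>v\<in>\<Lambda>. \<Union>x\<in>S. {v + x}. dist z y < \<epsilon>"
      by (rule bexI[rotated]) (use d in \<open>simp add: add.commute\<close>)
  qed
  ultimately have "(\<Union>v\<in>\<Lambda>. \<Union>x\<in>S. {v + x}) = UNIV"
    by (metis UNIV_eq_I closure_closed)
  moreover have "(\<Union>v\<in>\<Lambda>. (+) v ` S) = (\<Union>v\<in>\<Lambda>. \<Union>x\<in>S. {v + x})" by auto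
  ultimately have "(\<Union>v\<in>\<Lambda>. (+) v ` S) = UNIV" by simp
  moreover have "meager_in euclidean (\<Union>v\<in>\<Lambda>. (+) v ` S)"
  proof (intro meager_in_UN nowhere_dense_imp_meager_in)
    have "{t::real ^ 'n. \<forall>i. t $ i \<in> \<int>} \<subseteq> range (\<lambda>m::int ^ 'n. \<chi> i. of_int (m $ i))"
    proof
      fix t :: "real ^ 'n" assume "t \<in> {t. \<forall>i. t $ i \<in> \<int>}"
      then show "t \<in> range (\<lambda>m::int ^ 'n. \<chi> i. of_int (m $ i))"
        by (intro image_eqI[of _ _ "\<chi> i. \<lfloor>t $ i\<rfloor>"]) (auto simp: vec_eq_iff)
    qed
    then show "countable \<Lambda>"
      unfolding \<Lambda>_def by (rule countable_image[OF countable_subset]) (intro countable_image countableI_type)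
    show "nowhere_dense_in euclidean ((+) v ` S)" for v
      using empty \<open>compact S\<close>
      by (simp add: nowhere_dense_in_euclidean_iff closure_closed closed_translation compact_imp_closed
          interior_translation S_def[symmetric])
  qed
  ultimately show False
    using open_not_meager[of "UNIV :: (real ^ 'n) set"] by simp
qed

section \<open>Sums of non-meager sets\<close>

lemma nfold_sum_0: "nfold_sum 0 T = {0}"
  by (auto simp: nfold_sum_def)

lemma nfold_sum_Suc: "nfold_sum (Suc m) T = {x + y |x y. x \<in> T \<and> y \<in> nfold_sum m T}"
proof (intro subset_antisym subsetI)
  fix z assume "z \<in> nfold_sum (Suc m) T"
  then obtain t where "z = (\<Sum>i<Suc m. t i)" "\<forall>i<Suc m. t i \<in> T"
    by (auto simp: nfold_sum_def)
  then have "z = t m + (\<Sum>i<m. t i)" "t m \<in> T" "(\<Sum>i<m. t i) \<in> nfold_sum m T"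
    by (auto simp: nfold_sum_def add.commute)
  then show "z \<in> {x + y |x y. x \<in> T \<and> y \<in> nfold_sum m T}" by blast
next
  fix z assume "z \<in> {x + y |x y. x \<in> T \<and> y \<in> nfold_sum m T}"
  then obtain x t where "z = x + (\<Sum>i<m. t i)" "x \<in> T" "\<forall>i<m. t i \<in> T"
    by (auto simp: nfold_sum_def)
  then show "z \<in> nfold_sum (Suc m) T"
    unfolding nfold_sum_def
    by (intro CollectI exI[of _ "t(m := x)"]) (auto simp: add.commute less_Suc_eq)
qed

lemma nfold_sum_add: "nfold_sum (m + k) T = {x + y |x y. x \<in> nfold_sum m T \<and> y \<in> nfold_sum k T}"
proof (induction m)
  case (Suc m)
  show ?case
  proof (intro subset_antisym subsetI)
    fix z assume "z \<in> nfold_sum (Suc m + k) T"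
    then obtain x u v where "z = x + (u + v)" "x \<in> T" "u \<in> nfold_sum m T" "v \<in> nfold_sum k T"
      using Suc by (auto simp: nfold_sum_Suc)
    then show "z \<in> {x + y |x y. x \<in> nfold_sum (Suc m) T \<and> y \<in> nfold_sum k T}"
      unfolding nfold_sum_Suc by (intro CollectI exI[of _ "x + u"] exI[of _ v]) (auto simp: add.assoc)
  next
    fix z assume "z \<in> {x + y |x y. x \<in> nfold_sum (Suc m) T \<and> y \<in> nfold_sum k T}"
    then obtain x u v where "z = x + u + v" "x \<in> T" "u \<in> nfold_sum m T" "v \<in> nfold_sum k T"
      by (auto simp: nfold_sum_Suc)
    then show "z \<in> nfold_sum (Suc m + k) T"
      by (auto simp: nfold_sum_Suc Suc add.assoc intro!: exI)
  qed
qed (auto simp: nfold_sum_0)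

text \<open>Regroups the terms so that a statement on difference sets, applied to the iterated sum,
  covers the iterated sum of differences.\<close>

lemma nfold_sum_diff:
  fixes T :: "'a::ab_group_add set"
  shows "nfold_sum m {a - b |a b. a \<in> T \<and> b \<in> T} = {x - y |x y. x \<in> nfold_sum m T \<and> y \<in> nfold_sum m T}"
proof (intro subset_antisym subsetI)
  fix z assume "z \<in> nfold_sum m {a - b |a b. a \<in> T \<and> b \<in> T}"
  then obtain t where z: "z = (\<Sum>i<m. t i)" and "\<forall>i<m. \<exists>a b. t i = a - b \<and> a \<in> T \<and> b \<in> T"
    by (auto simp: nfold_sum_def)
  then obtain a b where "\<forall>i<m. t i = a i - b i \<and> a i \<in> T \<and> b i \<in> T" by metis
  then have "z = (\<Sum>i<m. a i) - (\<Sum>i<m. b i)" "\<forall>i<m. a i \<in> T" "\<forall>i<m. b i \<in> T"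
    by (simp_all add: z sum_subtractf[symmetric])
  then show "z \<in> {x - y |x y. x \<in> nfold_sum m T \<and> y \<in> nfold_sum m T}"
    unfolding nfold_sum_def by blast
next
  fix z assume "z \<in> {x - y |x y. x \<in> nfold_sum m T \<and> y \<in> nfold_sum m T}"
  then obtain a b where "z = (\<Sum>i<m. a i) - (\<Sum>i<m. b i)" "\<forall>i<m. a i \<in> T" "\<forall>i<m. b i \<in> T"
    by (auto simp: nfold_sum_def)
  then show "z \<in> nfold_sum m {a - b |a b. a \<in> T \<and> b \<in> T}"
    unfolding nfold_sum_def
    by (intro CollectI exI[of _ "\<lambda>i. a i - b i"]) (auto simp: sum_subtractf)
qed

lemma analytic_set_nfold_sum:
  fixes A :: "'a::real_normed_vector set"
  shows "analytic_set A \<Longrightarrow> analytic_set (nfold_sum m A)"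
  by (induction m) (auto simp: nfold_sum_0 nfold_sum_Suc analytic_set_singleton analytic_set_sums)

text \<open>The sums \<open>V\<^sub>1 + ... + V\<^sub>m\<close> of members of \<open>\<B>\<close>.
  The recursion follows the induction on the number of summands and makes countability
  evident.\<close>

primrec box_sums :: "'a::comm_monoid_add set set \<Rightarrow> nat \<Rightarrow> 'a set set" where
  "box_sums \<B> 0 = {{0}}"
| "box_sums \<B> (Suc m) = (\<lambda>(V, W). {x + y |x y. x \<in> V \<and> y \<in> W}) ` (\<B> \<times> box_sums \<B> m)"

lemma countable_box_sums: "countable \<B> \<Longrightarrow> countable (box_sums \<B> m)"
  by (induction m) auto

lemma box_sumsE:
  assumes "W \<in> box_sums \<B> m"
  obtains V where "\<And>i. i < m \<Longrightarrow> V i \<in> \<B>" "\<And>x. (\<And>i. i < m \<Longrightarrow> x i \<in> V i) \<Longrightarrow> (\<Sum>i<m. x i) \<in> W"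
proof -
  have "\<exists>V. (\<forall>i<m. V i \<in> \<B>) \<and> (\<forall>x. (\<forall>i<m. x i \<in> V i) \<longrightarrow> (\<Sum>i<m. x i) \<in> W)"
    using assms
  proof (induction m arbitrary: W)
    case (Suc m)
    then obtain U W' where W: "W = {x + y |x y. x \<in> U \<and> y \<in> W'}" "U \<in> \<B>" "W' \<in> box_sums \<B> m"
      by auto
    obtain V where V: "\<forall>i<m. V i \<in> \<B>" "\<forall>x. (\<forall>i<m. x i \<in> V i) \<longrightarrow> (\<Sum>i<m. x i) \<in> W'"
      using Suc.IH[OF W(3)] by blast
    \<comment> \<open>The outermost summand of the recursion receives the last index
      \<open>m\<close>.\<close>
    have "(\<Sum>i<Suc m. x i) \<in> W" if x: "\<forall>i<Suc m. x i \<in> (V(m := U)) i" for x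
    proof -
      have "x m \<in> U" using x[rule_format, of m] by simp
      moreover have "x i \<in> V i" if "i < m" for i
        using x[rule_format, of i] that by simp
      then have "(\<Sum>i<m. x i) \<in> W'" using V(2) by blast
      moreover have "(\<Sum>i<Suc m. x i) = x m + (\<Sum>i<m. x i)"
        by (simp add: add.commute)
      ultimately show ?thesis unfolding W(1) by blast
    qed
    then show ?case
      using V(1) W(2) by (intro exI[of _ "V(m := U)"]) (auto simp: less_Suc_eq)
  qed simp
  then show thesis using that by blast
qed

text \<open>The Kuratowski--Ulam argument, carried out one summand at a time.\<close>

lemma nonmeager_nfold_sum_cover:
  fixes A K :: "'a::real_normed_vector set"
  assumes AK: "A \<subseteq> K" "\<not> meager_in (top_of_set K) A" and \<B>: "countable \<B>"
    and base: "\<And>U. openin (top_of_set K) U \<Longrightarrow> U \<noteq> {} \<Longrightarrow> \<exists>V\<in>\<B>. V \<subseteq> U"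
    and \<F>: "countable \<F>" "\<And>F. F \<in> \<F> \<Longrightarrow> closed F" and cover: "nfold_sum m A \<subseteq> \<Union>\<F>"
  shows "\<exists>F\<in>\<F>. \<exists>W\<in>box_sums \<B> m. W \<subseteq> F"
  using \<F> cover
proof (induction m arbitrary: \<F>)
  case 0
  then show ?case by (auto simp: nfold_sum_0)
next
  case (Suc m)
  \<comment> \<open>\<open>Z (F, W)\<close> consists of the translations that carry \<open>W\<close>
    into \<open>F\<close>.\<close>
  define Z where "Z = (\<lambda>(F, W). {a::'a. \<forall>y\<in>W. a + y \<in> F})"
  have "a \<in> (\<Union>p\<in>\<F> \<times> box_sums \<B> m. A \<inter> Z p)" if a: "a \<in> A" for a
  proof -
    \<comment> \<open>With \<open>a\<close> fixed as one summand, the translated closed sets cover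
      the sum of the remaining ones, so the induction hypothesis puts \<open>a\<close> into some
      \<open>Z p\<close>.\<close>
    have "\<exists>F\<in>(\<lambda>F. (+) a -` F) ` \<F>. \<exists>W\<in>box_sums \<B> m. W \<subseteq> F"
    proof (rule Suc.IH)
      show "nfold_sum m A \<subseteq> \<Union>((\<lambda>F. (+) a -` F) ` \<F>)"
      proof
        fix y assume "y \<in> nfold_sum m A"
        then have "a + y \<in> \<Union>\<F>" using Suc.prems(3) a unfolding nfold_sum_Suc by blast
        then show "y \<in> \<Union>((\<lambda>F. (+) a -` F) ` \<F>)" by auto
      qed
    qed (use Suc.prems in \<open>auto intro!: closed_vimage continuous_intros\<close>)
    then show ?thesis using a by (auto simp: Z_def)
  qed
  then have "A \<subseteq> (\<Union>p\<in>\<F> \<times> box_sums \<B> m. A \<inter> Z p)" by blast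
  then have "\<not> meager_in (top_of_set K) (\<Union>p\<in>\<F> \<times> box_sums \<B> m. A \<inter> Z p)"
    using AK(2) meager_in_subset by blast
  moreover have "countable (\<F> \<times> box_sums \<B> m)"
    using Suc.prems(1) countable_box_sums[OF \<B>] by auto
  ultimately have "\<exists>p\<in>\<F> \<times> box_sums \<B> m. \<not> nowhere_dense_in (top_of_set K) (A \<inter> Z p)"
    by (metis (lifting) meager_in_UN nowhere_dense_imp_meager_in)
  then obtain F W where FW: "F \<in> \<F>" "W \<in> box_sums \<B> m" and
    "\<not> nowhere_dense_in (top_of_set K) (A \<inter> Z (F, W))"
    by blast
  then have "top_of_set K interior_of (top_of_set K closure_of (A \<inter> Z (F, W))) \<noteq> {}"
    using AK(1) by (auto simp: nowhere_dense_in_def)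
  then obtain V where V: "V \<in> \<B>" "V \<subseteq> top_of_set K interior_of (top_of_set K closure_of (A \<inter> Z (F, W)))"
    using base openin_interior_of by metis
  \<comment> \<open>Closedness passes from the dense part of \<open>V\<close> in \<open>A\<close> to
    all of \<open>V\<close>.\<close>
  have "closed (Z (F, W))"
  proof -
    have "Z (F, W) = (\<Inter>y\<in>W. (\<lambda>a. a + y) -` F)" by (auto simp: Z_def)
    moreover have "closed ((\<lambda>a. a + y) -` F)" for y
      using Suc.prems(2)[OF FW(1)] by (intro closed_vimage continuous_intros)
    ultimately show ?thesis by auto
  qed
  then have "top_of_set K closure_of (A \<inter> Z (F, W)) \<subseteq> K \<inter> Z (F, W)"
    using AK(1) by (intro closure_of_minimal closedin_closed_Int) auto
  then have "V \<subseteq> Z (F, W)"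
    using V(2) interior_of_subset[of "top_of_set K" "top_of_set K closure_of (A \<inter> Z (F, W))"] by blast
  then have "{x + y |x y. x \<in> V \<and> y \<in> W} \<subseteq> F" by (auto simp: Z_def)
  moreover have "{x + y |x y. x \<in> V \<and> y \<in> W} \<in> box_sums \<B> (Suc m)"
    using V(1) FW(2) by auto
  ultimately show ?case using FW(1) by blast
qed

text \<open>A proper affine subspace is closed with empty interior, and it contains the affine hull
  of each of its subsets.\<close>

lemma not_flat_not_subset_affine:
  fixes V S :: "'a::euclidean_space set"
  assumes "\<not> flat V" "subspace S" "dim S < DIM('a)"
  shows "\<not> V \<subseteq> (+) a ` S"
proof
  assume "V \<subseteq> (+) a ` S"
  then have "affine hull V \<subseteq> (+) a ` S"
    using assms(2) by (intro hull_minimal) (auto simp: affine_translation[symmetric] subspace_imp_affine)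
  moreover have "nowhere_dense_in euclidean ((+) a ` S)"
    using assms(2,3)
    by (simp add: nowhere_dense_in_euclidean_iff closure_closed closed_translation closed_subspace
        interior_translation empty_interior_lowdim)
  ultimately have "flat V"
    unfolding flat_def by (rule nowhere_dense_in_subset[rotated])
  with assms(1) show False by blast
qed

text \<open>The differences are chosen one after another: the span of the earlier ones is a proper
  subspace, and its translate through a point of \<open>V k\<close> cannot contain
  \<open>V k\<close>. Independence is stated with indexed coefficients, so that repeated differences
  are excluded as well.\<close>

lemma not_flat_independent_differences:
  fixes V :: "nat \<Rightarrow> 'a::euclidean_space set"
  assumes V: "\<And>i. i < k \<Longrightarrow> V i \<noteq> {}" "\<And>i. i < k \<Longrightarrow> \<not> flat (V i)" and k: "k \<le> DIM('a)"
  shows "\<exists>a b. (\<forall>i<k. a i \<in> V i \<and> b i \<in> V i) \<and>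
    (\<forall>c. (\<Sum>i<k. c i *\<^sub>R (b i - a i)) = 0 \<longrightarrow> (\<forall>i<k. c i = 0))"
  using assms
proof (induction k)
  case (Suc k)
  have "\<exists>a b. (\<forall>i<k. a i \<in> V i \<and> b i \<in> V i) \<and>
      (\<forall>c. (\<Sum>i<k. c i *\<^sub>R (b i - a i)) = 0 \<longrightarrow> (\<forall>i<k. c i = 0))"
    by (rule Suc.IH) (use Suc.prems in auto)
  then obtain a b where ab: "\<forall>i<k. a i \<in> V i \<and> b i \<in> V i"
    and ind: "\<And>c. (\<Sum>i<k. c i *\<^sub>R (b i - a i)) = 0 \<Longrightarrow> \<forall>i<k. c i = 0"
    by blast
  define S where "S = span ((\<lambda>i. b i - a i) ` {..<k})"
  have "dim S \<le> card ((\<lambda>i. b i - a i) ` {..<k})"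
    unfolding S_def by (simp add: dim_le_card')
  also have "\<dots> \<le> k"
    using card_image_le[of "{..<k}" "\<lambda>i. b i - a i"] by simp
  finally have dim: "dim S < DIM('a)" using Suc.prems(3) by simp
  obtain u where u: "u \<in> V k" using Suc.prems(1)[of k] by blast
  have "\<not> V k \<subseteq> (+) u ` S"
    using Suc.prems(2)[of k] dim by (intro not_flat_not_subset_affine) (auto simp: S_def)
  then obtain v where v: "v \<in> V k" "v \<notin> (+) u ` S" by blast
  then have vS: "v - u \<notin> S" by (metis add.commute diff_add_cancel image_eqI)
  have "\<forall>i<Suc k. c i = 0" if c: "(\<Sum>i<Suc k. c i *\<^sub>R ((b(k := v)) i - (a(k := u)) i)) = 0" for c
  proof -
    have sum: "(\<Sum>i<k. c i *\<^sub>R (b i - a i)) + c k *\<^sub>R (v - u) = 0"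
      using c by simp
    have "c k = 0"
    proof (rule ccontr)
      assume "c k \<noteq> 0"
      then have "v - u = (- 1 / c k) *\<^sub>R (\<Sum>i<k. c i *\<^sub>R (b i - a i))"
        using sum by (simp add: eq_vector_fraction_iff add_eq_0_iff2 add_eq_0_iff)
      moreover have "(\<Sum>i<k. c i *\<^sub>R (b i - a i)) \<in> S"
        unfolding S_def by (intro span_sum span_scale span_base) auto
      ultimately have "v - u \<in> S"
        unfolding S_def by (simp only: span_scale)
      with vS show False by blast
    qed
    then show ?thesis using sum ind by (auto simp: less_Suc_eq)
  qed
  then show ?case
    using ab u v(1)
    by (intro exI[of _ "a(k := u)"] exI[of _ "b(k := v)"]) (auto simp: less_Suc_eq)
qed simp

text \<open>Continuity of addition allows bounded connected pieces to be replaced by their closures,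
  which are compact.\<close>

lemma sum_closure_subset:
  fixes V :: "'i \<Rightarrow> 'a::real_normed_vector set"
  assumes F: "closed F" and V: "\<And>x. (\<And>i. i \<in> I \<Longrightarrow> x i \<in> V i) \<Longrightarrow> (\<Sum>i\<in>I. x i) \<in> F"
    and x: "\<And>i. i \<in> I \<Longrightarrow> x i \<in> closure (V i)"
  shows "(\<Sum>i\<in>I. x i) \<in> F"
proof -
  have "\<forall>i\<in>I. \<exists>s. (\<forall>k. s k \<in> V i) \<and> s \<longlonglongrightarrow> x i"
    using x unfolding closure_sequential by blast
  then obtain s where s: "\<And>i k. i \<in> I \<Longrightarrow> s i k \<in> V i" "\<And>i. i \<in> I \<Longrightarrow> s i \<longlonglongrightarrow> x i"
    by metis
  have "(\<lambda>k. \<Sum>i\<in>I. s i k) \<longlonglongrightarrow> (\<Sum>i\<in>I. x i)"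
    by (intro tendsto_sum s(2))
  then show ?thesis
    using closed_sequentially[OF F] V s(1) by meson
qed

lemma nonmeager_nfold_sum:
  fixes K A :: "(real ^ 'n) set"
  assumes flat: "nowhere_flat K" and lc: "locally connected K"
    and AK: "A \<subseteq> K" "\<not> meager_in (top_of_set K) A"
  shows "\<not> meager_in euclidean (nfold_sum CARD('n) A)"
proof
  assume "meager_in euclidean (nfold_sum CARD('n) A)"
  then obtain \<N> where \<N>: "countable \<N>" "\<And>N. N \<in> \<N> \<Longrightarrow> interior (closure N) = {}"
      "nfold_sum CARD('n) A = \<Union>\<N>"
    unfolding meager_in_def nowhere_dense_in_euclidean_iff by blast
  obtain \<C> :: "(real ^ 'n) set set" where \<C>: "countable \<C>" "\<And>C. C \<in> \<C> \<Longrightarrow> openin (top_of_set K) C"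
      "{} \<notin> \<C>" "\<And>T. openin (top_of_set K) T \<Longrightarrow> \<exists>\<U>. \<U> \<subseteq> \<C> \<and> T = \<Union>\<U>"
    using subset_second_countable by metis
  \<comment> \<open>The chosen sets need not form a base; it suffices that every non-empty open
    subset of \<open>K\<close> contains one of them.\<close>
  have "\<exists>V. openin (top_of_set K) V \<and> V \<noteq> {} \<and> connected V \<and> bounded V \<and> V \<subseteq> C" if C: "C \<in> \<C>" for C
  proof -
    obtain x where x: "x \<in> C" using \<C>(3) C by (cases "C = {}") auto
    have "openin (top_of_set K) (C \<inter> ball x 1)"
      using \<C>(2)[OF C] by (intro openin_Int_open) auto
    moreover have "x \<in> C \<inter> ball x 1" using x by simp
    ultimately obtain V where "openin (top_of_set K) V" "connected V" "x \<in> V" "V \<subseteq> C \<inter> ball x 1"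
      using lc unfolding locally_connected by meson
    then show ?thesis using bounded_subset[OF bounded_ball, of V x 1] by blast
  qed
  then obtain v where v: "\<And>C. C \<in> \<C> \<Longrightarrow> openin (top_of_set K) (v C)" "\<And>C. C \<in> \<C> \<Longrightarrow> v C \<noteq> {}"
      "\<And>C. C \<in> \<C> \<Longrightarrow> connected (v C)" "\<And>C. C \<in> \<C> \<Longrightarrow> bounded (v C)" "\<And>C. C \<in> \<C> \<Longrightarrow> v C \<subseteq> C"
    by metis
  have "\<exists>F\<in>closure ` \<N>. \<exists>W\<in>box_sums (v ` \<C>) CARD('n). W \<subseteq> F"
  proof (rule nonmeager_nfold_sum_cover[OF AK])
    show "\<exists>V\<in>v ` \<C>. V \<subseteq> U" if U: "openin (top_of_set K) U" "U \<noteq> {}" for U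
    proof -
      obtain C where "C \<in> \<C>" "C \<subseteq> U" using \<C>(4)[OF U(1)] U(2) by blast
      then show ?thesis using v(5) by blast
    qed
    show "nfold_sum CARD('n) A \<subseteq> \<Union>(closure ` \<N>)"
      unfolding \<N>(3) by (intro Union_least) (meson UN_upper closure_subset order_trans)
  qed (use \<C>(1) \<N>(1) in auto)
  then obtain N W where NW: "N \<in> \<N>" "W \<in> box_sums (v ` \<C>) CARD('n)" "W \<subseteq> closure N" by blast
  obtain V where V: "\<And>i. i < CARD('n) \<Longrightarrow> V i \<in> v ` \<C>"
      and VW: "\<And>x. (\<And>i. i < CARD('n) \<Longrightarrow> x i \<in> V i) \<Longrightarrow> (\<Sum>i<CARD('n). x i) \<in> W"
    using box_sumsE[OF NW(2)] by blast
  have V': "openin (top_of_set K) (V i)" "V i \<noteq> {}" "connected (V i)" "bounded (V i)" if i: "i < CARD('n)" for i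
  proof -
    obtain C where "C \<in> \<C>" "V i = v C" using V[OF i] by blast
    then show "openin (top_of_set K) (V i)" "V i \<noteq> {}" "connected (V i)" "bounded (V i)"
      using v by simp_all
  qed
  have "\<not> flat (V i)" if "i < CARD('n)" for i
    using flat V'(1,2)[OF that] by (simp add: nowhere_flat_def)
  then have "\<exists>a b. (\<forall>i<CARD('n). a i \<in> V i \<and> b i \<in> V i) \<and>
      (\<forall>c. (\<Sum>i<CARD('n). c i *\<^sub>R (b i - a i)) = 0 \<longrightarrow> (\<forall>i<CARD('n). c i = 0))"
    using V'(2) by (intro not_flat_independent_differences) auto
  then obtain a b where ab: "\<And>i. i < CARD('n) \<Longrightarrow> a i \<in> V i" "\<And>i. i < CARD('n) \<Longrightarrow> b i \<in> V i"
      and ind: "\<And>c. (\<Sum>i<CARD('n). c i *\<^sub>R (b i - a i)) = 0 \<Longrightarrow> \<forall>i<CARD('n). c i = 0"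
    by blast
  \<comment> \<open>The iterated sum is indexed by numbers, the sum of continua by coordinates;
    \<open>h\<close> translates between the two.\<close>
  obtain h :: "'n \<Rightarrow> nat" where h: "bij_betw h UNIV {..<CARD('n)}"
    using ex_bij_betw_finite_nat[OF finite_class.finite_UNIV] unfolding atLeast0LessThan by blast
  have hlt: "h i < CARD('n)" for i using bij_betwE[OF h] by auto
  have hinv: "h (inv h j) = j" if "j < CARD('n)" for j
    using h that by (simp add: bij_betw_inv_into_right)
  have invh: "inv h (h i) = i" for i
    using h by (simp add: bij_betw_imp_inj_on)
  have reindex: "(\<Sum>i\<in>UNIV. g (h i)) = (\<Sum>j<CARD('n). g j)" for g :: "nat \<Rightarrow> real ^ 'n"
    using h by (rule sum.reindex_bij_betw)
  have "interior {\<Sum>i\<in>UNIV. x i | x. \<forall>i. x i \<in> closure (V (h i))} \<noteq> {}"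
  proof (rule sum_of_continua_interior[where a = "\<lambda>i. a (h i)" and b = "\<lambda>i. b (h i)"])
    show "compact (closure (V (h i)))" "connected (closure (V (h i)))" for i
      using V'(3,4)[OF hlt] by (simp_all add: connected_imp_connected_closure)
    show "a (h i) \<in> closure (V (h i))" "b (h i) \<in> closure (V (h i))" for i
      using ab[OF hlt[of i]] closure_subset[of "V (h i)"] by blast+
    define L where "L = (\<lambda>t::real ^ 'n. \<Sum>i\<in>UNIV. t $ i *\<^sub>R (b (h i) - a (h i)))"
    have "linear L"
      unfolding L_def by (intro linear_compose_sum ballI) (simp add: linear_iff scaleR_left_distrib)
    moreover have "t = 0" if "L t = 0" for t
    proof -
      have "(\<Sum>j<CARD('n). t $ inv h j *\<^sub>R (b j - a j)) = 0"
        using that reindex[of "\<lambda>j. t $ inv h j *\<^sub>R (b j - a j)"] by (simp add: L_def invh)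
      then have "\<forall>j<CARD('n). t $ inv h j = 0" by (rule ind)
      then have "t $ i = 0" for i using hlt[of i] invh[of i] by metis
      then show ?thesis by (simp add: vec_eq_iff)
    qed
    ultimately show "inj (\<lambda>t::real ^ 'n. \<Sum>i\<in>UNIV. t $ i *\<^sub>R (b (h i) - a (h i)))"
      unfolding L_def[symmetric] using linear_injective_0 by blast
  qed
  moreover have "{\<Sum>i\<in>UNIV. x i | x. \<forall>i. x i \<in> closure (V (h i))} \<subseteq> closure N"
  proof clarify
    fix x :: "'n \<Rightarrow> real ^ 'n" assume x: "\<forall>i. x i \<in> closure (V (h i))"
    show "(\<Sum>i\<in>UNIV. x i) \<in> closure N"
    proof (rule sum_closure_subset[where V = "\<lambda>i. V (h i)"])
      fix y :: "'n \<Rightarrow> real ^ 'n" assume y: "\<And>i. i \<in> UNIV \<Longrightarrow> y i \<in> V (h i)"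
      have "y (inv h j) \<in> V j" if "j < CARD('n)" for j
        using y[of "inv h j"] hinv[OF that] by simp
      then have "(\<Sum>j<CARD('n). y (inv h j)) \<in> W" by (rule VW)
      then show "(\<Sum>i\<in>UNIV. y i) \<in> closure N"
        using reindex[of "\<lambda>j. y (inv h j)"] NW(3) by (auto simp: invh)
    qed (use x in auto)
  qed
  then have "interior {\<Sum>i\<in>UNIV. x i | x. \<forall>i. x i \<in> closure (V (h i))} \<subseteq> interior (closure N)"
    by (rule interior_mono)
  ultimately show False
    unfolding \<N>(2)[OF NW(1)] by (simp only: subset_empty)
qed

text \<open>A bound \<open>M\<close> on \<open>A\<close> yields the bound \<open>m * M\<close> on
  the \<open>m\<close>-fold sum, hence on a ball, where boundedness from above forces
  continuity.\<close>

lemma in_family_B_if_nfold_sum_interior: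
  fixes A :: "'a::real_normed_vector set"
  assumes "interior (nfold_sum m A) \<noteq> {}"
  shows "A \<in> family_B"
  unfolding family_B_def
proof (clarsimp)
  fix f :: "'a \<Rightarrow> real"
  assume f: "Modules.additive f" and "bdd_above (f ` A)"
  then obtain M where M: "\<And>x. x \<in> A \<Longrightarrow> f x \<le> M" by (auto simp: bdd_above_def)
  obtain c r where r: "r > 0" "ball c r \<subseteq> nfold_sum m A"
    using assms by (meson ex_in_conv mem_interior)
  have "f x \<le> real m * M" if x: "x \<in> ball c r" for x
  proof -
    obtain t where "x = (\<Sum>i<m. t i)" "\<forall>i<m. t i \<in> A"
      using r(2) x by (auto simp: nfold_sum_def)
    then have "f x = (\<Sum>i<m. f (t i))" "\<forall>i<m. f (t i) \<le> M"
      using additive.sum[OF f] M by auto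
    then show ?thesis
      using sum_bounded_above[of "{..<m}" "\<lambda>i. f (t i)" M] by simp
  qed
  then show "continuous_on UNIV f"
    by (rule additive_bdd_above_ball_continuous[OF f r(1)])
qed

theorem corollary2:
  fixes K A :: "(real ^ 'n) set"
  assumes "nowhere_flat K"
    and "locally connected K"
    and "A \<subseteq> K"
    and "analytic_set A"
    and "\<not> meager_in (top_of_set K) A"
  shows "\<not> meager_in euclidean (nfold_sum CARD('n) A)
    \<and> analytic_set (nfold_sum CARD('n) A)
    \<and> interior (nfold_sum (2 * CARD('n)) A) \<noteq> {}
    \<and> 0 \<in> interior (nfold_sum CARD('n) {a - b | a b. a \<in> A \<and> b \<in> A})
    \<and> A \<in> family_A
    \<and> (family_A :: (real ^ 'n) set set) = family_B
    \<and> (family_B :: (real ^ 'n) set set) \<subseteq> family_C"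
proof -
  have nm: "\<not> meager_in euclidean (nfold_sum CARD('n) A)"
    using assms by (intro nonmeager_nfold_sum)
  have an: "analytic_set (nfold_sum CARD('n) A)"
    using assms(4) by (rule analytic_set_nfold_sum)
  \<comment> \<open>The \<open>2n\<close>-fold sum is the sum of two copies of the non-meager
    analytic \<open>n\<close>-fold sum.\<close>
  have int: "interior (nfold_sum (2 * CARD('n)) A) \<noteq> {}"
    using Piccard_Pettis(1)[OF an nm] by (simp add: mult_2 nfold_sum_add)
  moreover have "0 \<in> interior (nfold_sum CARD('n) {a - b | a b. a \<in> A \<and> b \<in> A})"
    using Piccard_Pettis(2)[OF an nm] by (simp add: nfold_sum_diff)
  moreover have "A \<in> family_A"
    unfolding family_A_eq_family_B using int by (rule in_family_B_if_nfold_sum_interior)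
  ultimately show ?thesis
    using nm an family_A_eq_family_B family_B_subset_family_C by blast
qed

end
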